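(* Let $\gamma,\Gamma,\delta$ be the constants in the assumptions on the cost functions, let $\mu_n(\mathcal{L})$ and $\mu_2(\mathcal{L})$ be the largest and second smallest eigenvalues of the graph Laplacian $\mathcal{L}=AA^{\mathsf T}$, let $B=\frac{\mu_n(\mathcal{L})\delta}{\gamma\sqrt{\mu_2(\mathcal{L})}}$, and let $$\epsilon\in\left(0,\ \frac{\mu_2(\mathcal{L})}{\mu_n(\mathcal{L})}\sqrt{\frac{\gamma}{\Gamma}}\right),\qquad \alpha^*=\frac{e^{-\epsilon^2}}{(1+\epsilon)^2}\left(\frac{\gamma}{\Gamma}\frac{\mu_2(\mathcal{L})}{\mu_n(\mathcal{L})}\right)^2 .$$ Define $$\xi=\sqrt{1-\alpha^*+\alpha^*\epsilon\frac{\mu_n(\mathcal{L})}{\mu_2(\mathcal{L})}\sqrt{\frac{\Gamma}{\gamma}}},\qquad \zeta=\frac{B(\alpha^*\Gamma(1+\epsilon))^2}{2\mu_2^2(\mathcal{L})},\qquad \eta_0=\frac{\xi(1-\xi)}{\zeta},\qquad \eta_1=\frac{1-\xi}{\zeta}.$$ Then the iteration $\lambda_{k+1}=\lambda_k+\alpha^*\tilde d_k$, where $\tilde d_k$ is the $\epsilon$-approximate Newton direction, exhibits the following three phases of convergence. 1. (Strict decrease phase) While $\|g_k\|_{\mathcal{L}}\ge\eta_1$: $$q(\lambda_{k+1})-q(\lambda_k)\le-\frac12\,\frac{e^{-2\epsilon^2}}{(1+\epsilon)^2}\,\frac{\gamma^3}{\Gamma^2}\,\frac{\mu_2^2(\mathcal{L})}{\mu_n^4(\mathcal{L})}\,\eta_1^2.$$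 2. (Quadratic decrease phase) While $\eta_0\le\|g_k\|_{\mathcal{L}}\le\eta_1$: $$\|g_{k+1}\|_{\mathcal{L}}\le\frac1{\eta_1}\|g_k\|_{\mathcal{L}}^2.$$ 3. (Terminal phase) When $\|g_k\|_{\mathcal{L}}\le\eta_0$: $$\|g_{k+1}\|_{\mathcal{L}}\le\sqrt{1-\alpha^*+\alpha^*\epsilon\frac{\mu_n(\mathcal{L})}{\mu_2(\mathcal{L})}\sqrt{\frac{\Gamma}{\gamma}}}\ \|g_k\|_{\mathcal{L}}.$$
   Context: Network flow problem. $\mathcal{G}=(\mathcal{N},\mathcal{E})$ is a directed graph with $n=N$ nodes and $E$ edges, whose underlying graph is connected, non-bipartite and has algebraic connectivity bounded below by a constant $\omega$. $A$ is its $N\times E$ incidence matrix: $A_{i,e}=1$ if edge $e$ leaves node $i$, $-1$ if it enters $i$, $0$ otherwise; $b\in\mathbf{1}^\perp$. The primal problem is $\min_x\sum_{e}\Phi_e(x^{(e)})$ subject to $Ax=b$, where each $\Phi_e:\mathbb{R}\to\mathbb{R}$ is strictly convex and twice continuously differentiable with $\gamma\le\ddot\Phi_e\le\Gamma$ (constants $0<\gamma\le\Gamma$) and $\left|\frac1{\ddot\Phi_e(x)}-\frac1{\ddot\Phi_e(\hat x)}\right|\le\delta|x-\hat x|$ for all $x,\hat x$ and all $e$. Dual. For $\lambda\in\mathbb{R}^N$ and $e=(i,j)$ let $x^{(e)}(\lambda)=[\dot\Phi_e]^{-1}(\lambda^{(i)}-\lambda^{(j)})$, and let $q(\lambda)=\lambda^{\mathsf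 T}(Ax(\lambda)-b)-\sum_e\Phi_e(x^{(e)}(\lambda))$, which is convex and is to be minimized. Write $g_k=\nabla q(\lambda_k)=Ax(\lambda_k)-b$ and $H_k=H(\lambda_k)=\nabla^2q(\lambda_k)=A\,\mathrm{diag}\big(1/\ddot\Phi_e(x^{(e)}(\lambda_k))\big)A^{\mathsf T}$. For a positive semidefinite $S$, $\|u\|_S=\sqrt{u^{\mathsf T}Su}$; $\mathcal{L}=AA^{\mathsf T}$ is the unweighted Laplacian. Approximate Newton direction. The exact Newton direction $d_k$ satisfies $H_kd_k=-g_k$. The $\epsilon$-approximate Newton direction $\tilde d_k$ is the output of an approximate linear solver applied to this system with precision $\epsilon$; it satisfies $\|\tilde d_k-d_k\|_{H_k}\le\epsilon\|d_k\|_{H_k}$ and $\tilde d_k=-Z_kg_k$, where $Z_k$ is a linear operator (symmetric matrix) approximating the pseudo-inverse $H_k^\dagger$ in the sense that $e^{-\epsilon^2}v^{\mathsf T}H_k^\dagger v\le v^{\mathsf T}Z_kv\le e^{\epsilon^2}v^{\mathsf T}H_k^\dagger v$ for all $v\in\mathbf{1}^\perp$. *)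

theory Defs
  imports "HOL-Analysis.Analysis" "Graph_Theory.Digraph_Component"
begin

section \<open>Graphs and matrices\<close>

text \<open>Nodes and edges are the elements of two finite types, so that a graph satisfies
  \<open>verts G = UNIV\<close> and \<open>arcs G = UNIV\<close> and its incidence matrix is a matrix over these types.
  For a loop the defining clauses of the incidence matrix would contradict each other; the locale
  \<open>digraph\<close> excludes loops and parallel edges, but not pairs of opposite edges.\<close>

definition bipartite :: "('n, 'e) pre_digraph \<Rightarrow> bool" where
  "bipartite G \<longleftrightarrow>
     (\<exists>U V. U \<union> V = verts G \<and> U \<inter> V = {} \<and>
        (\<forall>e \<in> arcs G. tail G e \<in> U \<and> head G e \<in> V \<or> tail G e \<in> V \<and> head G e \<in> U))"

definition incidence_matrix :: "('n, 'e) pre_digraph \<Rightarrow> real ^ 'e ^ 'n" where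
  "incidence_matrix G =
     (\<chi> i e. if tail G e = i then 1 else if head G e = i then - 1 else 0)"

definition diag_matrix :: "real ^ 'e \<Rightarrow> real ^ 'e ^ 'e" where
  "diag_matrix w = (\<chi> i j. if i = j then w $ i else 0)"

definition laplacian :: "('n, 'e::finite) pre_digraph \<Rightarrow> real ^ 'n ^ 'n" where
  "laplacian G = incidence_matrix G ** transpose (incidence_matrix G)"

definition mat_norm :: "real ^ 'n ^ 'n \<Rightarrow> real ^ 'n \<Rightarrow> real" where
  "mat_norm S u = sqrt (u \<bullet> (S *v u))"

definition eigenspace :: "real ^ 'n ^ 'n \<Rightarrow> real \<Rightarrow> (real ^ 'n) set" where
  "eigenspace S \<mu> = {v. S *v v = \<mu> *\<^sub>R v}"

text \<open>Eigenvalues are counted with geometric multiplicity, which for the symmetric matrices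
  considered here is the same as the algebraic one.\<close>

definition eigenvalue_mset :: "real ^ 'n ^ 'n \<Rightarrow> real multiset" where
  "eigenvalue_mset S =
     (\<Sum>\<mu> \<in> {\<mu>. \<exists>v. v \<noteq> 0 \<and> S *v v = \<mu> *\<^sub>R v}. replicate_mset (dim (eigenspace S \<mu>)) \<mu>)"

text \<open>The \<open>k\<close>-th smallest eigenvalue, where \<open>k = 1, \<dots>, n\<close>.\<close>

definition kth_eigenvalue :: "real ^ 'n ^ 'n \<Rightarrow> nat \<Rightarrow> real" where
  "kth_eigenvalue S k = sorted_list_of_multiset (eigenvalue_mset S) ! (k - 1)"

text \<open>The Moore--Penrose pseudo-inverse is the unique matrix satisfying the four Penrose
  conditions.\<close>

definition pseudo_inverse :: "real ^ 'n ^ 'n \<Rightarrow> real ^ 'n ^ 'n" where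
  "pseudo_inverse S =
     (THE X. S ** X ** S = S \<and> X ** S ** X = X \<and>
             transpose (S ** X) = S ** X \<and> transpose (X ** S) = X ** S)"


section \<open>Costs and the dual problem\<close>

definition strictly_convex :: "(real \<Rightarrow> real) \<Rightarrow> bool" where
  "strictly_convex f \<longleftrightarrow>
     (\<forall>x y t. x \<noteq> y \<longrightarrow> 0 < t \<longrightarrow> t < 1 \<longrightarrow>
        f ((1 - t) * x + t * y) < (1 - t) * f x + t * f y)"

definition twice_continuously_differentiable :: "(real \<Rightarrow> real) \<Rightarrow> bool" where
  "twice_continuously_differentiable f \<longleftrightarrow>
     (\<forall>x. f field_differentiable at x) \<and>
     (\<forall>x. deriv f field_differentiable at x) \<and>
     continuous_on UNIV (deriv (deriv f))"

definition admissible_cost :: "real \<Rightarrow> real \<Rightarrow> real \<Rightarrow> (real \<Rightarrow> real) \<Rightarrow> bool" where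
  "admissible_cost \<gamma> \<Gamma> \<delta> f \<longleftrightarrow>
     strictly_convex f \<and> twice_continuously_differentiable f \<and>
     (\<forall>x. \<gamma> \<le> deriv (deriv f) x \<and> deriv (deriv f) x \<le> \<Gamma>) \<and>
     (\<forall>x y. \<bar>1 / deriv (deriv f) x - 1 / deriv (deriv f) y\<bar> \<le> \<delta> * \<bar>x - y\<bar>)"

definition flow ::
  "('n, 'e) pre_digraph \<Rightarrow> ('e \<Rightarrow> real \<Rightarrow> real) \<Rightarrow> real ^ 'n \<Rightarrow> real ^ 'e" where
  "flow G \<Phi> l = (\<chi> e. inv (deriv (\<Phi> e)) (l $ tail G e - l $ head G e))"

definition dual ::
  "('n, 'e::finite) pre_digraph \<Rightarrow> ('e \<Rightarrow> real \<Rightarrow> real) \<Rightarrow> real ^ 'n \<Rightarrow> real ^ 'n \<Rightarrow> real" where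
  "dual G \<Phi> b l =
     l \<bullet> (incidence_matrix G *v flow G \<Phi> l - b) - (\<Sum>e\<in>UNIV. \<Phi> e (flow G \<Phi> l $ e))"

text \<open>The gradient and the Hessian of \<^term>\<open>dual G \<Phi> b\<close>, in the closed form valid under
  \<^const>\<open>admissible_cost\<close>.\<close>

definition dual_gradient ::
  "('n, 'e::finite) pre_digraph \<Rightarrow> ('e \<Rightarrow> real \<Rightarrow> real) \<Rightarrow> real ^ 'n \<Rightarrow> real ^ 'n \<Rightarrow> real ^ 'n" where
  "dual_gradient G \<Phi> b l = incidence_matrix G *v flow G \<Phi> l - b"

definition dual_hessian ::
  "('n, 'e::finite) pre_digraph \<Rightarrow> ('e \<Rightarrow> real \<Rightarrow> real) \<Rightarrow> real ^ 'n \<Rightarrow> real ^ 'n ^ 'n" where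
  "dual_hessian G \<Phi> l =
     incidence_matrix G ** diag_matrix (\<chi> e. 1 / deriv (deriv (\<Phi> e)) (flow G \<Phi> l $ e))
       ** transpose (incidence_matrix G)"


section \<open>Approximate Newton directions\<close>

text \<open>\<open>d\<close> is only determined up to the kernel of the Hessian \<open>H\<close>, on which its seminorm
  vanishes. The condition \<open>(\<Sum>i\<in>UNIV. v $ i) = 0\<close> says that \<open>v\<close> is orthogonal to the
  all-ones vector.\<close>

definition approx_newton_direction ::
  "real \<Rightarrow> real ^ 'n ^ 'n \<Rightarrow> real ^ 'n \<Rightarrow> real ^ 'n \<Rightarrow> bool" where
  "approx_newton_direction \<epsilon> H g d' \<longleftrightarrow>
     (\<exists>d. H *v d = - g \<and> mat_norm H (d' - d) \<le> \<epsilon> * mat_norm H d) \<and>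
     (\<exists>Z. transpose Z = Z \<and> d' = - (Z *v g) \<and>
        (\<forall>v. (\<Sum>i\<in>UNIV. v $ i) = 0 \<longrightarrow>
           exp (- (\<epsilon>\<^sup>2)) * (v \<bullet> (pseudo_inverse H *v v)) \<le> v \<bullet> (Z *v v) \<and>
           v \<bullet> (Z *v v) \<le> exp (\<epsilon>\<^sup>2) * (v \<bullet> (pseudo_inverse H *v v))))"

end

theory Submission
  imports Defs
begin

text \<open>
Write \<open>m = \<mu>\<^sub>n / \<mu>\<^sub>2\<close>, \<open>\<kappa> = \<Gamma> / \<gamma>\<close>, \<open>M = m \<surd>\<kappa>\<close> and \<open>G = \<parallel>g\<parallel>\<close> in the Laplacian seminorm. Everything
concerns one iteration. The Hessian is \<open>H = A W A\<^sup>T\<close> with edge weights \<open>w\<close> between \<open>1/\<Gamma>\<close> and \<open>1/\<gamma>\<close>, so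
all comparisons between \<open>H\<close>, its value at another point and the Laplacian \<open>A A\<^sup>T\<close> cost at most a power
of \<open>\<kappa>\<close>, and those between seminorms and the Euclidean norm at most a power of \<open>m\<close>.

\<^bold>\<open>Strict decrease.\<close> The dual function splits into convex conjugates of the edge costs, each of which
is \<open>1/\<gamma>\<close>-smooth. The resulting quadratic upper model of the dual is evaluated at the step, where the
spectral bounds on \<open>Z\<close> bound the slope and the error bound on the direction bounds the curvature term.

\<^bold>\<open>Gradient recursion.\<close> The new gradient is \<open>(g + \<alpha> H d') + A r\<close>, where the entry \<open>r\<^sub>e\<close> is the remainder of
a first-order expansion of the inverse derivative of the cost of the edge \<open>e\<close>. The linear part is at
most \<open>(1 - \<alpha> + \<alpha> \<epsilon> M) G = \<xi>\<^sup>2 G\<close>. If \<open>\<parallel>A r\<parallel> \<le> \<zeta> G\<^sup>2\<close> held, both remaining phases would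
follow from \<open>\<xi>\<^sup>2 G + \<zeta> G\<^sup>2\<close>, because this is at most \<open>\<xi> G\<close> below \<open>\<eta>\<^sub>0\<close> and at most \<open>G\<^sup>2 / \<eta>\<^sub>1\<close> above it.

\<^bold>\<open>The difficulty.\<close> When \<open>\<mu>\<^sub>2 > 1\<close>, the Hessian need not be Lipschitz with constant \<open>B\<close>; on the
triangle, for example, the remainder can exceed what \<open>B\<close> would allow. Estimating the entries
\<open>r\<^sub>e\<close> in the \<open>\<ell>\<^sup>1\<close>-norm gives only \<open>\<parallel>A r\<parallel> \<le> C \<zeta> G\<^sup>2\<close> with
\<open>C = \<surd>(2/m) (\<kappa> + 2) / (3 \<kappa>)\<close>. This suffices when \<open>C \<le> 1\<close>. When \<open>C > 1\<close>, both \<open>m\<close> and \<open>\<kappa>\<close> are smaller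
than 2, and two further effects make up for the loss.

\<^item> The edge weights vary by at most \<open>1/\<gamma> - 1/\<Gamma>\<close>. Hence \<open>r\<^sub>e\<close> also has a linear bound, and a mixture
  of both bounds holds: for every \<open>t\<close> in \<open>[0, 1]\<close> the remainder is at most
  \<open>(1 - t) \<alpha> (1 + \<epsilon>) m (\<kappa> - 1) G + t\<^sup>2 C \<zeta> G\<^sup>2\<close>. The choice \<open>t = 4/5\<close> settles the limit of \<open>\<epsilon>\<close> to 0.
\<^item> The spectral bounds on \<open>Z\<close> improve the linear part: they put \<open>d'\<close> within
  \<open>\<sigma> = \<epsilon>\<^sup>2 + \<epsilon>\<^sup>4/2\<close> of the multiple \<open>c d\<close> of the exact direction, where \<open>c = 1 + \<epsilon>\<^sup>4/2\<close>, instead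
  of within \<open>\<epsilon>\<close> of \<open>d\<close>. This controls the terms of first order in \<open>\<epsilon>\<close>, and unless \<open>\<epsilon>\<close> is small it is
  sufficient with \<open>t = 1\<close>.

The trade-off is the scalar lemma \<open>contraction_bound\<close>; its hardest case is \<open>saturation_inequality\<close>. The
analysis behind it is \<open>inverse_deriv_remainder\<close> for a single edge, and \<open>approx_newton_step\<close> and
\<open>gradient_remainder_bound\<close> for the network. The eigenvalues enter only through Rayleigh quotients, which
\<open>laplacian_bounds\<close> provides.
\<close>

section \<open>Eigenvalues of symmetric matrices\<close>

lemma inner_symmetric_matrix:
  fixes S :: "real ^ 'n::finite ^ 'n"
  assumes "transpose S = S"
  shows "(S *v x) \<bullet> y = x \<bullet> (S *v y)"
  by (metis assms dot_lmul_matrix transpose_matrix_vector)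

text \<open>The Rayleigh quotient attains its minimum on the compact unit sphere of an invariant subspace, and
a minimizer is an eigenvector. This one fact yields the spectral theorem and both eigenvalue bounds.\<close>

lemma rayleigh_minimizer:
  fixes S :: "real ^ 'n::finite ^ 'n"
  assumes sym: "transpose S = S" and V: "subspace V"
    and inv: "\<And>v. v \<in> V \<Longrightarrow> S *v v \<in> V" and a: "a \<in> V" "a \<noteq> 0"
  obtains \<nu> v where "v \<in> V" "v \<noteq> 0" "S *v v = \<nu> *\<^sub>R v"
    "\<And>u. u \<in> V \<Longrightarrow> \<nu> * (u \<bullet> u) \<le> u \<bullet> (S *v u)"
proof -
  define K where "K = sphere 0 1 \<inter> V"
  have "compact K" unfolding K_def
    by (intro compact_Int_closed compact_sphere closed_subspace V)
  moreover have "a /\<^sub>R norm a \<in> K" using a V by (auto simp: K_def subspace_scale)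
  moreover have "continuous_on K (\<lambda>u. u \<bullet> (S *v u))"
    by (intro continuous_intros linear_continuous_on) (simp add: matrix_vector_mul_linear linear_linear)
  ultimately obtain v where v: "v \<in> K" and min: "\<And>u. u \<in> K \<Longrightarrow> v \<bullet> (S *v v) \<le> u \<bullet> (S *v u)"
    using continuous_attains_inf[of K] by (metis empty_iff)
  define \<nu> where "\<nu> = v \<bullet> (S *v v)"
  have vV: "v \<in> V" and nv: "norm v = 1" using v by (auto simp: K_def)
  have vv: "v \<bullet> v = 1" using nv by (simp add: dot_square_norm)
  have bound: "\<nu> * (u \<bullet> u) \<le> u \<bullet> (S *v u)" if "u \<in> V" for u
  proof (cases "u = 0")
    case False
    have "u /\<^sub>R norm u \<in> K" using that False V by (auto simp: K_def subspace_scale)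
    from min[OF this] have "\<nu> \<le> (u \<bullet> (S *v u)) / (norm u)\<^sup>2"
      by (simp add: \<nu>_def matrix_vector_mult_scaleR power2_eq_square field_simps)
    then show ?thesis using False by (simp add: field_simps dot_square_norm)
  qed simp
  define w where "w = S *v v - \<nu> *\<^sub>R v"
  have wV: "w \<in> V" unfolding w_def by (intro subspace_diff V inv vV subspace_scale)
  \<comment> \<open>The form \<open>u \<bullet> S u - \<nu> u \<bullet> u\<close> is nonnegative on \<open>V\<close> and vanishes at \<open>v\<close>; along the line through
    \<open>v\<close> in the direction of its gradient \<open>w\<close> this forces \<open>w = 0\<close>.\<close>
  have quad: "0 \<le> 2 * c * (w \<bullet> w) + c\<^sup>2 * (w \<bullet> (S *v w) - \<nu> * (w \<bullet> w))" for c
  proof -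
    have "v + c *\<^sub>R w \<in> V" by (intro subspace_add V vV subspace_scale wV)
    from bound[OF this]
    have "\<nu> * ((v + c *\<^sub>R w) \<bullet> (v + c *\<^sub>R w)) \<le> (v + c *\<^sub>R w) \<bullet> (S *v (v + c *\<^sub>R w))" .
    moreover have "v \<bullet> (S *v w) = w \<bullet> (S *v v)"
      by (metis inner_commute inner_symmetric_matrix[OF sym])
    moreover have "w \<bullet> (S *v v) = w \<bullet> w + \<nu> * (w \<bullet> v)"
      by (simp add: w_def algebra_simps)
    ultimately show ?thesis
      by (simp add: matrix_vector_right_distrib matrix_vector_mult_scaleR inner_add_left inner_add_right
          inner_commute \<nu>_def[symmetric] vv power2_eq_square algebra_simps)
  qed
  have "w = 0"
  proof (rule ccontr)
    assume "w \<noteq> 0"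
    then have p: "0 < w \<bullet> w" by simp
    define f where "f = \<bar>w \<bullet> (S *v w) - \<nu> * (w \<bullet> w)\<bar> + 1"
    have f: "f > 0" "w \<bullet> (S *v w) - \<nu> * (w \<bullet> w) \<le> f" by (auto simp: f_def)
    have "0 \<le> 2 * (- (w \<bullet> w) / f) * (w \<bullet> w) + (- (w \<bullet> w) / f)\<^sup>2 * (w \<bullet> (S *v w) - \<nu> * (w \<bullet> w))"
      by (rule quad)
    also have "\<dots> \<le> 2 * (- (w \<bullet> w) / f) * (w \<bullet> w) + (- (w \<bullet> w) / f)\<^sup>2 * f"
      by (intro add_left_mono mult_left_mono f) simp
    also have "\<dots> = - (w \<bullet> w)\<^sup>2 / f" using f by (simp add: field_simps power2_eq_square)
    also have "\<dots> < 0" using p f by simp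
    finally show False by simp
  qed
  then have "S *v v = \<nu> *\<^sub>R v" by (simp add: w_def)
  moreover have "v \<noteq> 0" using nv by auto
  ultimately show thesis using that vV bound by blast
qed

lemma rayleigh_maximizer:
  fixes S :: "real ^ 'n::finite ^ 'n"
  assumes sym: "transpose S = S"
  obtains \<nu> v where "v \<noteq> 0" "S *v v = \<nu> *\<^sub>R v" "\<And>u. u \<bullet> (S *v u) \<le> \<nu> * (u \<bullet> u)"
proof -
  have neg: "(- S) *v u = - (S *v u)" for u
    by (simp add: vec_eq_iff matrix_vector_mult_def sum_negf)
  have "transpose (- S) = - S" using sym by (simp add: vec_eq_iff transpose_def)
  moreover have "axis undefined 1 \<noteq> (0 :: real ^ 'n)" by (simp add: axis_eq_0_iff)
  ultimately obtain \<nu> v where v: "v \<noteq> 0" "(- S) *v v = \<nu> *\<^sub>R v"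
    "\<And>u. \<nu> * (u \<bullet> u) \<le> u \<bullet> ((- S) *v u)"
    using rayleigh_minimizer[of "- S" UNIV "axis undefined 1 :: real ^ 'n"] by (metis UNIV_I subspace_UNIV)
  have "S *v v = (- \<nu>) *\<^sub>R v" using v(2) by (simp add: neg) (metis minus_minus)
  moreover have "u \<bullet> (S *v u) \<le> (- \<nu>) * (u \<bullet> u)" for u using v(3)[of u] by (simp add: neg)
  ultimately show thesis using that v(1) by blast
qed

lemma subspace_eigenspace: "subspace (eigenspace S \<mu>)"
  by (auto simp: subspace_def eigenspace_def matrix_vector_right_distrib matrix_vector_mult_scaleR
      algebra_simps)

lemma eigenspace_orthogonal:
  fixes S :: "real ^ 'n::finite ^ 'n"
  assumes sym: "transpose S = S" and "x \<in> eigenspace S \<mu>" "y \<in> eigenspace S \<nu>" "\<mu> \<noteq> \<nu>"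
  shows "x \<bullet> y = 0"
proof -
  have "\<mu> * (x \<bullet> y) = \<nu> * (x \<bullet> y)"
    using inner_symmetric_matrix[OF sym, of x y] assms(2,3) by (simp add: eigenspace_def)
  then show ?thesis using assms(4) by simp
qed

text \<open>The orthogonal complement of all eigenvectors is invariant; if it were nonzero, it would contain
another eigenvector.\<close>

lemma span_eigenspaces:
  fixes S :: "real ^ 'n::finite ^ 'n"
  assumes sym: "transpose S = S"
  shows "span (\<Union>\<mu>. eigenspace S \<mu>) = UNIV"
proof (rule ccontr)
  define T where "T = (\<Union>\<mu>. eigenspace S \<mu>)"
  define V where "V = {u. \<forall>x\<in>T. u \<bullet> x = 0}"
  assume "span (\<Union>\<mu>. eigenspace S \<mu>) \<noteq> UNIV"
  then obtain a where a: "a \<noteq> 0" "\<forall>x\<in>span T. a \<bullet> x = 0"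
    unfolding T_def using span_not_UNIV_orthogonal by blast
  have "subspace V" by (auto simp: V_def subspace_def inner_add_left)
  moreover have "S *v u \<in> V" if "u \<in> V" for u
  proof -
    have "(S *v u) \<bullet> x = 0" if "x \<in> eigenspace S \<mu>" for x \<mu>
    proof -
      have "u \<bullet> x = 0" using \<open>u \<in> V\<close> that by (auto simp: V_def T_def)
      then show ?thesis
        using that inner_symmetric_matrix[OF sym, of u x] by (simp add: eigenspace_def)
    qed
    then show ?thesis by (auto simp: V_def T_def)
  qed
  moreover have "a \<in> V" using a(2) by (auto simp: V_def span_base)
  ultimately obtain \<nu> v where v: "v \<in> V" "v \<noteq> 0" "S *v v = \<nu> *\<^sub>R v"
    using rayleigh_minimizer[OF sym] a(1) by metis
  then have "v \<in> T" by (auto simp: T_def eigenspace_def)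
  then show False using v(1,2) by (auto simp: V_def)
qed

definition eigenvalues :: "real ^ 'n ^ 'n \<Rightarrow> real set" where
  "eigenvalues S = {\<mu>. \<exists>v. v \<noteq> 0 \<and> S *v v = \<mu> *\<^sub>R v}"

text \<open>Finiteness matters because a sum of multisets over an infinite set is empty, and the size because
an index beyond the length of the sorted list of eigenvalues denotes an unspecified number. Both come from
gluing orthonormal bases of the eigenspaces to a basis of the whole space.\<close>

lemma finite_eigenvalues_and_size_eigenvalue_mset:
  fixes S :: "real ^ 'n::finite ^ 'n"
  assumes sym: "transpose S = S"
  shows "finite (eigenvalues S)" and "size (eigenvalue_mset S) = CARD('n)"
proof -
  have "\<exists>B. B \<subseteq> eigenspace S \<mu> \<and> pairwise orthogonal B \<and> independent B \<and>
      card B = dim (eigenspace S \<mu>) \<and> span B = eigenspace S \<mu> \<and> 0 \<notin> B" for \<mu>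
  proof -
    obtain B where B: "B \<subseteq> eigenspace S \<mu>" "pairwise orthogonal B" "\<And>x. x \<in> B \<Longrightarrow> norm x = 1"
      "independent B" "card B = dim (eigenspace S \<mu>)" "span B = eigenspace S \<mu>"
      using orthonormal_basis_subspace[OF subspace_eigenspace] by metis
    have "0 \<notin> B" using B(3)[of 0] by auto
    with B show ?thesis by blast
  qed
  then obtain B where B: "\<And>\<mu>. B \<mu> \<subseteq> eigenspace S \<mu>" "\<And>\<mu>. pairwise orthogonal (B \<mu>)"
    "\<And>\<mu>. independent (B \<mu>)" "\<And>\<mu>. card (B \<mu>) = dim (eigenspace S \<mu>)"
    "\<And>\<mu>. span (B \<mu>) = eigenspace S \<mu>" "\<And>\<mu>. 0 \<notin> B \<mu>" by metis
  define C where "C = (\<Union>\<mu>\<in>eigenvalues S. B \<mu>)"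
  have ne: "B \<mu> \<noteq> {} \<longleftrightarrow> \<mu> \<in> eigenvalues S" for \<mu>
  proof
    assume "B \<mu> \<noteq> {}"
    then obtain x where "x \<in> B \<mu>" by auto
    then have "x \<noteq> 0" "S *v x = \<mu> *\<^sub>R x" using B(1,6)[of \<mu>] by (auto simp: eigenspace_def)
    then show "\<mu> \<in> eigenvalues S" by (auto simp: eigenvalues_def)
  next
    assume "\<mu> \<in> eigenvalues S"
    then show "B \<mu> \<noteq> {}" using B(5)[of \<mu>] by (auto simp: eigenvalues_def eigenspace_def)
  qed
  have disj: "B \<mu> \<inter> B \<nu> = {}" if "\<mu> \<noteq> \<nu>" for \<mu> \<nu>
  proof -
    have "x = 0" if "x \<in> B \<mu>" "x \<in> B \<nu>" for x
    proof -
      have "x \<bullet> x = 0"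
        using eigenspace_orthogonal[OF sym _ _ \<open>\<mu> \<noteq> \<nu>\<close>] that B(1) by blast
      then show ?thesis by simp
    qed
    then show ?thesis using B(6) by blast
  qed
  have orth: "pairwise orthogonal C"
  proof (rule pairwiseI)
    fix x y assume "x \<in> C" "y \<in> C" "x \<noteq> y"
    then obtain \<mu> \<nu> where *: "x \<in> B \<mu>" "y \<in> B \<nu>" by (auto simp: C_def)
    show "orthogonal x y"
    proof (cases "\<mu> = \<nu>")
      case True
      then show ?thesis using * B(2)[of \<mu>] \<open>x \<noteq> y\<close> by (auto simp: pairwise_def)
    next
      case False
      then show ?thesis using * B(1) eigenspace_orthogonal[OF sym] unfolding orthogonal_def by blast
    qed
  qed
  have ind: "independent C"
    by (rule pairwise_orthogonal_independent[OF orth]) (use B(6) in \<open>auto simp: C_def\<close>)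
  then have finC: "finite C" by (rule independent_imp_finite)
  have "inj_on B (eigenvalues S)" by (rule inj_onI) (metis disj ne Int_absorb)
  moreover have "B ` eigenvalues S \<subseteq> Pow C" by (auto simp: C_def)
  ultimately show fin: "finite (eigenvalues S)"
    by (meson finC finite_Pow_iff finite_imageD finite_subset)
  have "(\<Union>\<mu>. eigenspace S \<mu>) \<subseteq> span C"
  proof
    fix x assume "x \<in> (\<Union>\<mu>. eigenspace S \<mu>)"
    then obtain \<mu> where x: "x \<in> eigenspace S \<mu>" by auto
    show "x \<in> span C"
    proof (cases "\<mu> \<in> eigenvalues S")
      case True
      then have "span (B \<mu>) \<subseteq> span C" by (intro span_mono) (auto simp: C_def)
      then show ?thesis using x B(5) by auto
    next
      case False
      then have "x = 0" using x by (auto simp: eigenvalues_def eigenspace_def)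
      then show ?thesis by (simp add: span_zero)
    qed
  qed
  then have "span C = UNIV"
    using span_eigenspaces[OF sym] by (metis span_minimal subspace_span top.extremum_uniqueI)
  then have "card C = CARD('n)"
    using ind by (metis dim_eq_card dim_span dim_UNIV DIM_cart DIM_real mult.right_neutral)
  moreover have "card C = (\<Sum>\<mu>\<in>eigenvalues S. card (B \<mu>))"
    unfolding C_def by (rule card_UN_disjoint[OF fin]) (use disj finC in \<open>auto simp: C_def independent_imp_finite[OF B(3)]\<close>)
  ultimately show "size (eigenvalue_mset S) = CARD('n)"
    by (simp add: eigenvalue_mset_def eigenvalues_def[symmetric] B(4))
qed

lemma count_eigenvalue_mset:
  fixes S :: "real ^ 'n::finite ^ 'n"
  assumes sym: "transpose S = S" and "\<mu> \<in> eigenvalues S"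
  shows "count (eigenvalue_mset S) \<mu> = dim (eigenspace S \<mu>)"
  using assms(2) finite_eigenvalues_and_size_eigenvalue_mset(1)[OF sym]
  by (simp add: eigenvalue_mset_def eigenvalues_def[symmetric] count_sum)

lemma dim_eigenspace_pos:
  assumes "v \<noteq> 0" "S *v v = \<mu> *\<^sub>R v"
  shows "0 < dim (eigenspace S \<mu>)"
proof -
  have "v \<in> eigenspace S \<mu>" using assms by (simp add: eigenspace_def)
  then show ?thesis using assms(1) by (metis dim_eq_0 gr0I singletonD subsetD)
qed

lemma eigenvalue_le_kth_eigenvalue_CARD:
  fixes S :: "real ^ 'n::finite ^ 'n"
  assumes sym: "transpose S = S" and "v \<noteq> 0" "S *v v = \<mu> *\<^sub>R v"
  shows "\<mu> \<le> kth_eigenvalue S CARD('n)"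
proof -
  define xs where "xs = sorted_list_of_multiset (eigenvalue_mset S)"
  have len: "length xs = CARD('n)" unfolding xs_def
    using finite_eigenvalues_and_size_eigenvalue_mset(2)[OF sym]
    by (metis mset_sorted_list_of_multiset size_mset)
  have "\<mu> \<in> eigenvalues S" using assms by (auto simp: eigenvalues_def)
  then have "0 < count (eigenvalue_mset S) \<mu>"
    using count_eigenvalue_mset[OF sym] dim_eigenspace_pos[OF assms(2,3)] by simp
  then have "\<mu> \<in> set xs" by (simp add: xs_def)
  then obtain i where "i < length xs" "xs ! i = \<mu>" by (auto simp: in_set_conv_nth)
  moreover have "sorted xs" by (simp add: xs_def)
  ultimately show ?thesis using len
    by (auto simp: kth_eigenvalue_def xs_def[symmetric] intro!: sorted_nth_mono)
qed

lemma rayleigh_le_largest_eigenvalue: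
  fixes S :: "real ^ 'n::finite ^ 'n"
  assumes sym: "transpose S = S"
  shows "u \<bullet> (S *v u) \<le> kth_eigenvalue S CARD('n) * (u \<bullet> u)"
proof -
  obtain \<nu> v where v: "v \<noteq> 0" "S *v v = \<nu> *\<^sub>R v" and max: "\<And>u. u \<bullet> (S *v u) \<le> \<nu> * (u \<bullet> u)"
    using rayleigh_maximizer[OF sym] by metis
  have "\<nu> \<le> kth_eigenvalue S CARD('n)" by (rule eigenvalue_le_kth_eigenvalue_CARD[OF sym v])
  then show ?thesis using max[of u] by (meson inner_ge_zero mult_right_mono order_trans)
qed

lemma second_smallest_le:
  fixes M :: "'a::linorder multiset"
  assumes "{#a, b#} \<subseteq># M"
  shows "sorted_list_of_multiset M ! 1 \<le> max a b"
proof -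
  define xs where "xs = sorted_list_of_multiset M"
  have M: "mset xs = M" and srt: "sorted xs" by (simp_all add: xs_def)
  have "2 \<le> length xs" using size_mset_mono[OF assms] M by (metis size_mset size_add_mset size_empty
        numeral_2_eq_2)
  then obtain x y zs where xs: "xs = x # y # zs"
    by (metis Suc_le_length_iff numeral_2_eq_2)
  have sub: "{#a, b#} \<subseteq># add_mset x (mset (y # zs))" using assms M xs by simp
  have "a \<in> set (y # zs) \<or> b \<in> set (y # zs)"
  proof (cases "a = x")
    case True
    then have "{#b#} \<subseteq># mset (y # zs)" using sub by simp
    then show ?thesis by simp
  next
    case False
    have "a \<in># add_mset x (mset (y # zs))" using sub by (meson mset_subset_eqD union_single_eq_member)
    then show ?thesis using False by auto
  qed
  then have "y \<le> a \<or> y \<le> b" using srt xs by auto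
  then show ?thesis unfolding xs_def[symmetric] xs by (auto simp: le_max_iff_disj)
qed

text \<open>The minimizer of the Rayleigh quotient orthogonal to the all-ones vector has an eigenvalue \<open>\<nu>\<close> that
occurs next to the eigenvalue 0 of the all-ones vector, even if \<open>\<nu> = 0\<close>, since the two eigenvectors are
independent. So the second smallest eigenvalue is at most \<open>max 0 \<nu>\<close>, and its positivity removes the 0.\<close>

lemma second_eigenvalue_le_rayleigh:
  fixes S :: "real ^ 'n::finite ^ 'n"
  assumes sym: "transpose S = S" and one: "S *v (\<chi> i. 1) = 0" and pos: "0 < kth_eigenvalue S 2"
    and u: "(\<Sum>i\<in>UNIV. u $ i) = 0"
  shows "kth_eigenvalue S 2 * (u \<bullet> u) \<le> u \<bullet> (S *v u)"
proof (cases "u = 0")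
  case False
  define e :: "real ^ 'n" where "e = (\<chi> i. 1)"
  define V where "V = {v. e \<bullet> v = 0}"
  have e: "e \<noteq> 0" "S *v e = 0 *\<^sub>R e" using one by (auto simp: e_def vec_eq_iff)
  have V: "subspace V" unfolding V_def by (rule subspace_hyperplane)
  have inv: "S *v v \<in> V" for v
    using inner_symmetric_matrix[OF sym, of e v] e by (simp add: V_def)
  have "e \<bullet> u = (\<Sum>i\<in>UNIV. u $ i)" by (simp add: e_def inner_vec_def)
  then have uV: "u \<in> V" using u by (simp add: V_def)
  obtain \<nu> v where v: "v \<in> V" "v \<noteq> 0" "S *v v = \<nu> *\<^sub>R v"
    and min: "\<And>u. u \<in> V \<Longrightarrow> \<nu> * (u \<bullet> u) \<le> u \<bullet> (S *v u)"
    using rayleigh_minimizer[OF sym V inv uV False] by blast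
  have ev: "0 \<in> eigenvalues S" "\<nu> \<in> eigenvalues S" using e v by (auto simp: eigenvalues_def)
  have "count {#0, \<nu>#} x \<le> count (eigenvalue_mset S) x" for x
  proof (cases "\<nu> = 0")
    case True
    have ev: "e \<bullet> v = 0" using v(1) by (simp add: V_def)
    have ne: "e \<noteq> v" using ev e(1) by auto
    have "independent {e, v}"
      by (rule pairwise_orthogonal_independent)
        (use ev e(1) v(2) in \<open>auto simp: pairwise_insert orthogonal_def inner_commute\<close>)
    moreover have "{e, v} \<subseteq> eigenspace S 0" using e(2) v(3) True by (auto simp: eigenspace_def)
    ultimately have "card {e, v} \<le> dim (eigenspace S 0)" by (metis independent_card_le_dim)
    then have "2 \<le> count (eigenvalue_mset S) 0"
      using ne count_eigenvalue_mset[OF sym \<open>0 \<in> eigenvalues S\<close>] by simp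
    then show ?thesis using True by simp
  next
    case False
    have "0 < count (eigenvalue_mset S) 0" "0 < count (eigenvalue_mset S) \<nu>"
      using count_eigenvalue_mset[OF sym] ev dim_eigenspace_pos[OF e] dim_eigenspace_pos[OF v(2,3)]
      by auto
    then show ?thesis using False by auto
  qed
  then have "{#0, \<nu>#} \<subseteq># eigenvalue_mset S" by (simp add: subseteq_mset_def)
  then have "kth_eigenvalue S 2 \<le> max 0 \<nu>"
    using second_smallest_le by (simp add: kth_eigenvalue_def)
  then have "kth_eigenvalue S 2 \<le> \<nu>" using pos by simp
  then show ?thesis using min[OF uV] by (meson inner_ge_zero mult_right_mono order_trans)
qed simp

section \<open>Weighted Gram matrices\<close>

lemma mat_norm_gram:
  fixes A :: "real ^ 'e::finite ^ 'n::finite"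
  shows "mat_norm (A ** transpose A) u = norm (u v* A)"
  by (simp add: mat_norm_def matrix_vector_mul_assoc[symmetric] dot_lmul_matrix[symmetric] norm_eq_sqrt_inner)

lemma weighted_gram_mult:
  fixes A :: "real ^ 'e::finite ^ 'n::finite"
  shows "(A ** diag_matrix w ** transpose A) *v u = A *v (\<chi> e. w $ e * (u v* A) $ e)"
proof -
  have "diag_matrix w *v z = (\<chi> e. w $ e * z $ e)" for z
    by (simp add: vec_eq_iff matrix_vector_mult_def diag_matrix_def if_distrib if_distribR sum.delta' cong: if_cong)
  then show ?thesis by (simp add: matrix_vector_mul_assoc[symmetric])
qed

lemma weighted_gram_inner:
  fixes A :: "real ^ 'e::finite ^ 'n::finite"
  shows "u \<bullet> ((A ** diag_matrix w ** transpose A) *v v) = (\<Sum>e\<in>UNIV. w $ e * (u v* A) $ e * (v v* A) $ e)"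
  unfolding weighted_gram_mult dot_lmul_matrix[symmetric]
  by (simp add: inner_vec_def algebra_simps)

lemma weighted_gram_symmetric:
  fixes A :: "real ^ 'e::finite ^ 'n::finite"
  shows "u \<bullet> ((A ** diag_matrix w ** transpose A) *v v) = v \<bullet> ((A ** diag_matrix w ** transpose A) *v u)"
  unfolding weighted_gram_inner by (simp add: algebra_simps)

lemma mat_norm_weighted_gram:
  fixes A :: "real ^ 'e::finite ^ 'n::finite"
  assumes "\<And>e. 0 \<le> w $ e"
  shows "(mat_norm (A ** diag_matrix w ** transpose A) u)\<^sup>2 = (\<Sum>e\<in>UNIV. w $ e * ((u v* A) $ e)\<^sup>2)"
    and "(mat_norm (A ** diag_matrix w ** transpose A) u)\<^sup>2 = u \<bullet> ((A ** diag_matrix w ** transpose A) *v u)"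
proof -
  have "u \<bullet> ((A ** diag_matrix w ** transpose A) *v u) = (\<Sum>e\<in>UNIV. w $ e * ((u v* A) $ e)\<^sup>2)"
    unfolding weighted_gram_inner by (simp add: power2_eq_square algebra_simps)
  moreover have "0 \<le> (\<Sum>e\<in>UNIV. w $ e * ((u v* A) $ e)\<^sup>2)"
    by (intro sum_nonneg mult_nonneg_nonneg assms) auto
  ultimately show "(mat_norm (A ** diag_matrix w ** transpose A) u)\<^sup>2 = (\<Sum>e\<in>UNIV. w $ e * ((u v* A) $ e)\<^sup>2)"
    and "(mat_norm (A ** diag_matrix w ** transpose A) u)\<^sup>2 = u \<bullet> ((A ** diag_matrix w ** transpose A) *v u)"
    unfolding mat_norm_def by simp_all
qed

lemma norm_vec_sq: "(norm (x :: real ^ 'e::finite))\<^sup>2 = (\<Sum>e\<in>UNIV. (x $ e)\<^sup>2)"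
  unfolding power2_norm_eq_inner inner_vec_def by (simp add: power2_eq_square)

text \<open>A seminorm given by \<open>A W A\<^sup>T\<close> is a Euclidean norm on edges, which makes its triangle inequality
available.\<close>

lemma mat_norm_weighted_gram_eq_norm:
  fixes A :: "real ^ 'e::finite ^ 'n::finite"
  assumes "\<And>e. 0 \<le> w $ e"
  shows "mat_norm (A ** diag_matrix w ** transpose A) u = norm (\<chi> e. sqrt (w $ e) * (u v* A) $ e)"
proof -
  have "u \<bullet> ((A ** diag_matrix w ** transpose A) *v u) = (norm (\<chi> e. sqrt (w $ e) * (u v* A) $ e))\<^sup>2"
    unfolding mat_norm_weighted_gram(2)[OF assms, symmetric] mat_norm_weighted_gram(1)[OF assms] norm_vec_sq
    by (simp add: power_mult_distrib assms)
  then show ?thesis by (simp add: mat_norm_def)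
qed

lemma mat_norm_weighted_gram_triangle:
  fixes A :: "real ^ 'e::finite ^ 'n::finite"
  assumes "\<And>e. 0 \<le> w $ e"
  shows "mat_norm (A ** diag_matrix w ** transpose A) u
    \<le> mat_norm (A ** diag_matrix w ** transpose A) (u - v) + mat_norm (A ** diag_matrix w ** transpose A) v"
proof -
  have "(\<chi> e. sqrt (w $ e) * (u v* A) $ e)
      = (\<chi> e. sqrt (w $ e) * ((u - v) v* A) $ e) + (\<chi> e. sqrt (w $ e) * (v v* A) $ e)"
    by (simp add: vec_eq_iff vector_matrix_mult_diff_distrib algebra_simps)
  then show ?thesis
    unfolding mat_norm_weighted_gram_eq_norm[OF assms] by (metis norm_triangle_ineq)
qed

lemma norm_matrix_mult_le:
  fixes A :: "real ^ 'e::finite ^ 'n::finite"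
  assumes ub: "\<And>u. norm (u v* A) \<le> s * norm u"
  shows "norm (A *v y) \<le> s * norm y"
proof -
  have "(norm (A *v y))\<^sup>2 = ((A *v y) v* A) \<bullet> y"
    by (simp add: dot_lmul_matrix power2_norm_eq_inner)
  also have "\<dots> \<le> norm ((A *v y) v* A) * norm y" by (rule norm_cauchy_schwarz)
  also have "\<dots> \<le> s * norm (A *v y) * norm y" by (intro mult_right_mono ub) auto
  finally have "norm (A *v y) * norm (A *v y) \<le> norm (A *v y) * (s * norm y)"
    by (simp add: power2_eq_square algebra_simps)
  moreover have "0 \<le> s * norm y"
  proof (cases "y = 0")
    case False
    obtain u :: "real ^ 'n" where u: "norm u = 1" using vector_choose_size[of 1] by auto
    then have "0 \<le> s" using ub[of u] by (metis mult.right_neutral norm_ge_zero order_trans)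
    then show ?thesis by simp
  qed simp
  ultimately show ?thesis by (cases "norm (A *v y) = 0") (auto simp: mult_le_cancel_left)
qed

text \<open>The part of a perturbation that is controlled linearly is measured in the Euclidean norm, where
only the operator norm of \<open>A\<close> is lost. The part that is controlled quadratically is measured in the
\<open>\<ell>\<^sup>1\<close>-norm: the sum of squares that appears there is already the square of a seminorm, and only the
norms of the columns are lost. For the incidence matrix \<open>s\<^sup>2\<close> is \<open>\<mu>\<^sub>n\<close>, whereas \<open>s k\<close> is \<open>\<surd>(2 \<mu>\<^sub>n)\<close>.\<close>

lemma norm_gram_split_le:
  fixes A :: "real ^ 'e::finite ^ 'n::finite"
  assumes ub: "\<And>u. norm (u v* A) \<le> s * norm u" and s: "0 \<le> s"
    and col: "\<And>e. norm (column e A) \<le> k"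
    and r: "\<And>e. \<bar>r $ e\<bar> \<le> a $ e + b e" and a: "\<And>e. 0 \<le> a $ e" and b: "\<And>e. 0 \<le> b e"
  shows "norm ((A *v r) v* A) \<le> s\<^sup>2 * norm a + s * k * (\<Sum>e\<in>UNIV. b e)"
proof -
  define p where "p = (\<chi> e. max (- a $ e) (min (a $ e) (r $ e)))"
  have p: "\<bar>p $ e\<bar> \<le> a $ e" for e using a[of e] by (simp add: p_def)
  have q: "\<bar>(r - p) $ e\<bar> \<le> b e" for e using a[of e] b[of e] r[of e] by (simp add: p_def)
  have "norm p \<le> norm a" by (rule norm_le_componentwise_cart) (use p a in \<open>simp add: abs_of_nonneg\<close>)
  then have "norm (A *v p) \<le> s * norm a"
    using norm_matrix_mult_le[OF ub, of p] s by (meson mult_left_mono order_trans)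
  moreover have "norm (A *v (r - p)) \<le> k * (\<Sum>e\<in>UNIV. b e)"
  proof -
    have "A *v (r - p) = (\<Sum>e\<in>UNIV. (r - p) $ e *\<^sub>R column e A)"
      by (simp add: matrix_mult_sum scalar_mult_eq_scaleR)
    also have "norm \<dots> \<le> (\<Sum>e\<in>UNIV. b e * k)"
      by (rule sum_norm_le) (use q col b in \<open>auto intro!: mult_mono simp del: vector_minus_component\<close>)
    finally show ?thesis by (simp add: sum_distrib_left mult.commute)
  qed
  moreover have "A *v r = A *v p + A *v (r - p)"
    by (simp add: matrix_vector_right_distrib[symmetric])
  ultimately have "norm (A *v r) \<le> s * norm a + k * (\<Sum>e\<in>UNIV. b e)"
    by (metis add_mono norm_triangle_le)
  then have "s * norm (A *v r) \<le> s * (s * norm a + k * (\<Sum>e\<in>UNIV. b e))"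
    using s by (rule mult_left_mono)
  then show ?thesis using ub[of "A *v r"] by (simp add: power2_eq_square algebra_simps)
qed

lemma norm_weighted_gram_le:
  fixes A :: "real ^ 'e::finite ^ 'n::finite"
  assumes ub: "\<And>u. norm (u v* A) \<le> s * norm u" and s: "0 \<le> s"
    and w: "\<And>e. 0 \<le> w $ e" "\<And>e. w $ e \<le> U"
  shows "norm ((A ** diag_matrix w ** transpose A) *v u) \<le> s * sqrt U * mat_norm (A ** diag_matrix w ** transpose A) u"
proof -
  define y where "y = (\<chi> e. w $ e * (u v* A) $ e)"
  have U: "0 \<le> U" using w order_trans by blast
  have "(norm y)\<^sup>2 = (\<Sum>e\<in>UNIV. (w $ e)\<^sup>2 * ((u v* A) $ e)\<^sup>2)"
    by (simp add: norm_vec_sq y_def power_mult_distrib)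
  also have "\<dots> \<le> (\<Sum>e\<in>UNIV. U * w $ e * ((u v* A) $ e)\<^sup>2)"
    by (intro sum_mono mult_right_mono) (auto simp: power2_eq_square intro!: mult_right_mono w)
  also have "\<dots> = (sqrt U * mat_norm (A ** diag_matrix w ** transpose A) u)\<^sup>2"
    using U by (simp add: power_mult_distrib mat_norm_weighted_gram(1)[OF w(1)] sum_distrib_left algebra_simps)
  finally have "norm y \<le> \<bar>sqrt U * mat_norm (A ** diag_matrix w ** transpose A) u\<bar>"
    using abs_le_square_iff[of "norm y"] by simp
  also have "\<dots> = sqrt U * mat_norm (A ** diag_matrix w ** transpose A) u"
    by (smt (verit) U mat_norm_weighted_gram(2)[OF w(1)] mat_norm_def real_sqrt_ge_zero zero_le_power2
        mult_nonneg_nonneg)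
  finally have "s * norm y \<le> s * (sqrt U * mat_norm (A ** diag_matrix w ** transpose A) u)"
    by (rule mult_left_mono[OF _ s])
  then show ?thesis using norm_matrix_mult_le[OF ub, of y] by (simp add: weighted_gram_mult y_def)
qed

text \<open>Removing the mean from \<open>d\<close> changes neither \<open>A\<^sup>T d\<close> nor the pairing with \<open>g\<close>, which is
orthogonal to the all-ones vector; after that, \<open>\<parallel>d\<parallel>\<close> is controlled by the seminorm of \<open>H\<close>, and
Cauchy--Schwarz applied to \<open>d\<^sup>T H d = - d\<^sup>T g\<close> gives the bound.\<close>

lemma newton_decrement_le:
  fixes A :: "real ^ 'e::finite ^ 'n::finite"
  assumes one: "(\<chi> i. 1) v* A = 0"
    and lb: "\<And>u. (\<Sum>i\<in>UNIV. u $ i) = 0 \<Longrightarrow> \<mu> * (norm u)\<^sup>2 \<le> (norm (u v* A))\<^sup>2" and \<mu>: "0 < \<mu>"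
    and w: "\<And>e. l \<le> w $ e" and l: "0 < l"
    and d: "(A ** diag_matrix w ** transpose A) *v d = - g"
  shows "l * \<mu> * (mat_norm (A ** diag_matrix w ** transpose A) d)\<^sup>2 \<le> (norm g)\<^sup>2"
proof -
  define N where "N = (mat_norm (A ** diag_matrix w ** transpose A) d)\<^sup>2"
  define c where "c = (\<Sum>i\<in>UNIV. d $ i) / real CARD('n)"
  define d0 where "d0 = d - c *\<^sub>R (\<chi> i. 1)"
  have w0: "0 \<le> w $ e" for e using w[of e] l by linarith
  have "(c *\<^sub>R (\<chi> i. 1)) v* A = c *\<^sub>R ((\<chi> i. 1) v* A)"
    by (metis matrix_vector_mult_scaleR transpose_matrix_vector)
  then have d0A: "d0 v* A = d v* A"
    by (simp add: d0_def one vector_matrix_mult_diff_distrib)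
  have "(\<Sum>i\<in>UNIV. d0 $ i) = 0" by (simp add: d0_def c_def sum_subtractf)
  then have "l * (\<mu> * (norm d0)\<^sup>2) \<le> l * (norm (d v* A))\<^sup>2"
    using lb[of d0] l by (simp add: d0A)
  also have "\<dots> \<le> N" unfolding N_def mat_norm_weighted_gram(1)[OF w0] norm_vec_sq sum_distrib_left
    by (intro sum_mono mult_right_mono w) auto
  finally have 1: "l * \<mu> * (norm d0)\<^sup>2 \<le> N" by simp
  have "(\<chi> i. 1) \<bullet> g = 0"
    using dot_lmul_matrix[of "\<chi> i. 1" A "\<chi> e. w $ e * (d v* A) $ e"] one d
    by (simp add: weighted_gram_mult)
  then have "N = - (d0 \<bullet> g)" unfolding N_def mat_norm_weighted_gram(2)[OF w0] d
    by (simp add: d0_def inner_diff_left)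
  then have "N \<le> norm d0 * norm g" using norm_cauchy_schwarz[of "- d0" g] by simp
  moreover have N0: "0 \<le> N" by (simp add: N_def)
  ultimately have "N\<^sup>2 \<le> (norm d0)\<^sup>2 * (norm g)\<^sup>2" by (metis power_mono power_mult_distrib)
  then have "l * \<mu> * N\<^sup>2 \<le> l * \<mu> * ((norm d0)\<^sup>2 * (norm g)\<^sup>2)" using l \<mu> by simp
  also have "\<dots> \<le> N * (norm g)\<^sup>2" using mult_right_mono[OF 1, of "(norm g)\<^sup>2"] by simp
  finally have "N * (l * \<mu> * N) \<le> N * (norm g)\<^sup>2" by (simp add: power2_eq_square algebra_simps)
  then have "l * \<mu> * N \<le> (norm g)\<^sup>2" using N0 by (cases "N = 0") (auto simp: mult_le_cancel_left)
  then show ?thesis by (simp add: N_def)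
qed

text \<open>The definite description denotes a pseudo-inverse as soon as one exists, because the four
conditions determine it: both one-sided products with \<open>H\<close> are determined, and \<open>Y = Y H Y\<close>.\<close>

lemma pseudo_inverse_mult:
  fixes H :: "real ^ 'n::finite ^ 'n"
  assumes ex: "H ** X ** H = H" "X ** H ** X = X" "transpose (H ** X) = H ** X" "transpose (X ** H) = X ** H"
  shows "H ** pseudo_inverse H ** H = H"
proof -
  let ?P = "\<lambda>X. H ** X ** H = H \<and> X ** H ** X = X \<and> transpose (H ** X) = H ** X \<and> transpose (X ** H) = X ** H"
  have uniq: "Y = X" if Y: "?P Y" for Y
  proof -
    have "H ** Y = transpose (H ** Y)" using Y by simp
    also have "\<dots> = transpose (H ** X ** H ** Y)" using ex by simp
    also have "\<dots> = transpose (H ** Y) ** transpose (H ** X)"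
      by (metis matrix_mul_assoc matrix_transpose_mul)
    also have "\<dots> = H ** Y ** H ** X" using Y ex by (simp add: matrix_mul_assoc)
    also have "\<dots> = H ** X" using Y by simp
    finally have HY: "H ** Y = H ** X" .
    have "Y ** H = transpose (Y ** H)" using Y by simp
    also have "\<dots> = transpose (Y ** (H ** X ** H))" using ex by simp
    also have "\<dots> = transpose (X ** H) ** transpose (Y ** H)"
      by (metis matrix_mul_assoc matrix_transpose_mul)
    also have "\<dots> = X ** (H ** Y ** H)" by (metis Y ex(4) matrix_mul_assoc)
    also have "\<dots> = X ** H" using Y by simp
    finally have YH: "Y ** H = X ** H" .
    have "Y = Y ** H ** Y" using Y by simp
    also have "\<dots> = X ** (H ** Y)" by (simp add: YH matrix_mul_assoc)
    also have "\<dots> = X" using ex by (simp add: HY matrix_mul_assoc)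
    finally show ?thesis .
  qed
  have "?P (pseudo_inverse H)" unfolding pseudo_inverse_def
    by (rule theI[where a = X and P = ?P], intro conjI ex, erule uniq)
  then show ?thesis by simp
qed

lemma matrix_mult_distribs:
  fixes A B C :: "real ^ 'n::finite ^ 'n"
  shows "(B + C) ** A = B ** A + C ** A" "A ** (B - C) = A ** B - A ** C" "(B - C) ** A = B ** A - C ** A"
  by (simp_all add: matrix_matrix_mult_def vec_eq_iff sum.distrib sum_subtractf algebra_simps)

text \<open>Let \<open>P\<close> be the projection to the all-ones vector, which spans the kernel of \<open>H\<close>. Then \<open>H + P\<close> is
invertible and \<open>(H + P)\<^sup>-\<^sup>1 - P\<close> satisfies the four conditions.\<close>

lemma pseudo_inverse_weighted_gram:
  fixes A :: "real ^ 'e::finite ^ 'n::finite" and w :: "real ^ 'e"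
  defines "H \<equiv> A ** diag_matrix w ** transpose A"
  assumes one: "(\<chi> i. 1) v* A = 0"
    and lb: "\<And>u. (\<Sum>i\<in>UNIV. u $ i) = 0 \<Longrightarrow> \<mu> * (norm u)\<^sup>2 \<le> (norm (u v* A))\<^sup>2" and \<mu>: "0 < \<mu>"
    and w: "\<And>e. l \<le> w $ e" and l: "0 < l"
  shows "H ** pseudo_inverse H ** H = H"
proof -
  define P :: "real ^ 'n ^ 'n" where "P = (\<chi> i j. 1 / real CARD('n))"
  define n where "n = real CARD('n)"
  have n: "n > 0" by (simp add: n_def)
  have P_mult: "P *v u = ((\<Sum>i\<in>UNIV. u $ i) / n) *\<^sub>R (\<chi> i. 1)" for u
    by (simp add: P_def n_def vec_eq_iff matrix_vector_mult_def sum_divide_distrib)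
  have Ht: "transpose H = H"
  proof -
    have "transpose (diag_matrix w) = diag_matrix w"
      by (auto simp: diag_matrix_def transpose_def vec_eq_iff)
    then show ?thesis by (simp add: H_def matrix_transpose_mul matrix_mul_assoc)
  qed
  have H1: "H *v (\<chi> i. 1) = 0"
    unfolding H_def weighted_gram_mult one by (simp add: matrix_vector_mult_def vec_eq_iff)
  have HP: "H ** P = 0"
  proof -
    have "(H ** P) *v u = 0" for u
      by (simp add: matrix_vector_mul_assoc[symmetric] P_mult matrix_vector_mult_scaleR H1)
    then show ?thesis by (simp add: matrix_eq)
  qed
  have Pt: "transpose P = P" by (simp add: P_def transpose_def)
  have PH: "P ** H = 0"
    using arg_cong[OF HP, of transpose] by (simp add: matrix_transpose_mul Ht Pt) (simp add: transpose_def vec_eq_iff)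
  have PP: "P ** P = P"
    by (simp add: P_def matrix_matrix_mult_def vec_eq_iff)
  have w0: "0 \<le> w $ e" for e using w[of e] l by linarith
  have "u = 0" if u: "(H + P) *v u = 0" for u
  proof -
    have "P *v ((H + P) *v u) = P *v u"
      by (simp add: matrix_vector_mul_assoc matrix_add_ldistrib PH PP)
    then have Pu: "P *v u = 0" using u by simp
    then have "H *v u = 0" using u by (simp add: matrix_vector_mult_add_rdistrib)
    then have "(\<Sum>e\<in>UNIV. w $ e * ((u v* A) $ e)\<^sup>2) = 0"
      using mat_norm_weighted_gram[OF w0, where u = u and A = A] by (simp add: H_def)
    moreover have "l * (norm (u v* A))\<^sup>2 \<le> (\<Sum>e\<in>UNIV. w $ e * ((u v* A) $ e)\<^sup>2)"
      unfolding norm_vec_sq sum_distrib_left by (intro sum_mono mult_right_mono w) auto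
    ultimately have "norm (u v* A) = 0" using l by (auto simp: mult_le_0_iff)
    moreover have "(\<Sum>i\<in>UNIV. u $ i) = 0"
      using Pu n by (simp add: P_mult vec_eq_iff)
    ultimately show "u = 0" using lb[of u] \<mu> by (auto simp: mult_le_0_iff)
  qed
  then obtain K where K: "K ** (H + P) = mat 1"
    by (metis matrix_left_invertible_ker)
  then have K': "(H + P) ** K = mat 1" by (metis matrix_left_right_inverse)
  define X where "X = K - P"
  have KP: "K ** P = P" "P ** K = P"
  proof -
    have "K ** ((H + P) ** P) = P" by (simp add: matrix_mul_assoc K)
    then show "K ** P = P" by (simp add: matrix_mult_distribs HP PP)
    have "(P ** (H + P)) ** K = P" by (simp add: matrix_mul_assoc[symmetric] K')
    then show "P ** K = P" by (simp add: matrix_add_ldistrib PH PP)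
  qed
  have HX: "H ** X = mat 1 - P"
    using K' by (simp add: X_def matrix_mult_distribs HP KP algebra_simps)
  have XH: "X ** H = mat 1 - P"
    using K by (simp add: X_def matrix_mult_distribs matrix_add_ldistrib PH KP algebra_simps)
  have tr: "transpose (mat 1 - P) = mat 1 - P"
    by (simp add: transpose_def P_def mat_def vec_eq_iff)
  show ?thesis
  proof (rule pseudo_inverse_mult)
    show "H ** X ** H = H" by (simp add: HX matrix_mult_distribs PH)
    show "X ** H ** X = X" by (simp add: XH matrix_mult_distribs)
      (simp add: X_def matrix_mult_distribs KP PP)
  qed (simp_all add: HX XH tr)
qed

section \<open>The inverse derivative of an edge cost\<close>

lemma admissible_cost_DERIV:
  assumes "admissible_cost \<gamma> \<Gamma> \<delta> f"
  shows "(f has_real_derivative deriv f x) (at x)"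
    and "(deriv f has_real_derivative deriv (deriv f) x) (at x)"
  using assms by (auto simp: admissible_cost_def twice_continuously_differentiable_def
      DERIV_deriv_iff_field_differentiable)

lemma deriv_cost_growth:
  assumes f: "admissible_cost \<gamma> \<Gamma> \<delta> f" and "x \<le> y"
  shows "\<gamma> * (y - x) \<le> deriv f y - deriv f x" "deriv f y - deriv f x \<le> \<Gamma> * (y - x)"
proof -
  have "deriv f x - \<gamma> * x \<le> deriv f y - \<gamma> * y"
    by (rule DERIV_nonneg_imp_nondecreasing[OF \<open>x \<le> y\<close>],
        rule exI[of _ "deriv (deriv f) _ - \<gamma>"])
      (use f in \<open>auto intro!: derivative_eq_intros admissible_cost_DERIV[OF f] simp: admissible_cost_def\<close>)
  then show "\<gamma> * (y - x) \<le> deriv f y - deriv f x" by (simp add: algebra_simps)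
  have "deriv f y - \<Gamma> * y \<le> deriv f x - \<Gamma> * x"
    by (rule DERIV_nonpos_imp_nonincreasing[OF \<open>x \<le> y\<close>],
        rule exI[of _ "deriv (deriv f) _ - \<Gamma>"])
      (use f in \<open>auto intro!: derivative_eq_intros admissible_cost_DERIV[OF f] simp: admissible_cost_def\<close>)
  then show "deriv f y - deriv f x \<le> \<Gamma> * (y - x)" by (simp add: algebra_simps)
qed

text \<open>The derivative has slope at least \<open>\<gamma>\<close> and is therefore surjective, so that \<open>inv\<close> is a genuine
right inverse.\<close>

lemma deriv_cost_inv:
  assumes f: "admissible_cost \<gamma> \<Gamma> \<delta> f" and \<gamma>: "0 < \<gamma>"
  shows "deriv f (inv (deriv f) s) = s"
proof -
  have "\<exists>x. deriv f x = s"
  proof -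
    define a where "a = \<bar>s - deriv f 0\<bar> / \<gamma>"
    have a: "a \<ge> 0" "\<gamma> * a = \<bar>s - deriv f 0\<bar>" using \<gamma> by (auto simp: a_def)
    have "deriv f (- a) \<le> s" using deriv_cost_growth(1)[OF f, of "- a" 0] a by auto
    moreover have "s \<le> deriv f a" using deriv_cost_growth(1)[OF f, of 0 a] a by auto
    moreover have "continuous_on {- a..a} (deriv f)"
      by (meson DERIV_isCont admissible_cost_DERIV(2)[OF f] continuous_at_imp_continuous_on)
    ultimately show ?thesis using IVT'[of "deriv f" "- a" s a] a(1) by auto
  qed
  then show ?thesis by (metis f_inv_into_f rangeI)
qed

text \<open>This is the \<open>1/\<gamma>\<close>-smoothness of the convex conjugate in terms of the points where it is attained:
with \<open>s = f' x\<close> and \<open>s + h = f' u\<close>, the left-hand side is \<open>f\<^sup>* (s + h) - f\<^sup>* s - h x\<close>. As a function of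
\<open>u\<close>, the difference of the two sides is largest at \<open>x\<close>.\<close>

lemma conjugate_cost_smooth:
  assumes f: "admissible_cost \<gamma> \<Gamma> \<delta> f" and \<gamma>: "0 < \<gamma>"
  shows "deriv f u * (u - x) - (f u - f x) \<le> (deriv f u - deriv f x)\<^sup>2 / (2 * \<gamma>)"
proof -
  define K where "K u = deriv f u * (u - x) - (f u - f x) - (deriv f u - deriv f x)\<^sup>2 / (2 * \<gamma>)" for u
  have K': "(K has_real_derivative
      deriv (deriv f) u * ((u - x) - (deriv f u - deriv f x) / \<gamma>)) (at u)" for u
    unfolding K_def using \<gamma>
    by (auto intro!: derivative_eq_intros admissible_cost_DERIV[OF f] simp: field_simps)
  have pos: "0 \<le> deriv (deriv f) u" for u using f \<gamma> by (meson admissible_cost_def less_imp_le order_trans)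
  have "K u \<le> K x"
  proof (cases "x \<le> u")
    case True
    show ?thesis
    proof (rule DERIV_nonpos_imp_nonincreasing[OF True])
      fix v assume "x \<le> v"
      then have "(v - x) - (deriv f v - deriv f x) / \<gamma> \<le> 0"
        using deriv_cost_growth(1)[OF f, of x v] \<gamma> by (simp add: field_simps)
      then show "\<exists>y. (K has_real_derivative y) (at v) \<and> y \<le> 0"
        using K' pos by (meson mult_nonneg_nonpos)
    qed
  next
    case False
    then have "u \<le> x" by simp
    then show ?thesis
    proof (rule DERIV_nonneg_imp_nondecreasing)
      fix v assume "v \<le> x"
      then have "0 \<le> (v - x) - (deriv f v - deriv f x) / \<gamma>"
        using deriv_cost_growth(1)[OF f, of v x] \<gamma> by (simp add: field_simps)
      then show "\<exists>y. (K has_real_derivative y) (at v) \<and> 0 \<le> y"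
        using K' pos by (meson mult_nonneg_nonneg)
    qed
  qed
  then show ?thesis by (simp add: K_def)
qed

text \<open>Here \<open>F\<close> is the increment of the derivative of a cost along a ray, so that \<open>y - w F y\<close> is the error of
the linearized inverse. The slope \<open>w\<close> of the inverse grows at most like \<open>w + \<delta> u\<close> and never exceeds \<open>U\<close>.
Let \<open>U'\<close> be the bound that is active at \<open>y\<close> and \<open>a\<close> the place where \<open>w + \<delta> u\<close> reaches it. The slack
\<open>U' F y - y\<close> is at least the integral of \<open>(U' - \<omega>) / \<omega>\<close> for \<open>\<omega> = w + \<delta> u\<close> over \<open>[0, a]\<close>, and by
Jensen's inequality with weight \<open>U' - \<omega>\<close> one may replace \<open>1 / \<omega>\<close> by its value at the barycentre
\<open>(U' + 2 w) / 3\<close>. This is the source of the factor \<open>U + 2 w\<close>, which is smaller than the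
\<open>3 U\<close> that follows from \<open>w \<le> U\<close> alone.\<close>

lemma secant_remainder_upper:
  fixes F c :: "real \<Rightarrow> real"
  assumes F: "\<And>u. 0 \<le> u \<Longrightarrow> (F has_real_derivative c u) (at u)" and F0: "F 0 = 0"
    and w0: "0 < w" "w \<le> U" and \<delta>: "0 < \<delta>"
    and cU: "\<And>u. 0 \<le> u \<Longrightarrow> 1 / U \<le> c u" and cw: "\<And>u. 0 \<le> u \<Longrightarrow> 1 / (w + \<delta> * u) \<le> c u"
    and y: "0 \<le> y"
  shows "y - w * F y \<le> \<delta> / 6 * (U + 2 * w) * (F y)\<^sup>2"
proof -
  define U' where "U' = min U (w + \<delta> * y)"
  define a where "a = (U' - w) / \<delta>"
  define \<mu> where "\<mu> = (U' + 2 * w) / 3"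
  have U': "w \<le> U'" "U' \<le> U" "U' \<le> w + \<delta> * y" using w0 \<delta> y by (auto simp: U'_def)
  have U'0: "0 < U'" using U' w0 by linarith
  have a: "0 \<le> a" "a \<le> y" "U' = w + \<delta> * a" using U' \<delta> by (auto simp: a_def field_simps)
  have \<mu>: "0 < \<mu>" using U' w0 by (simp add: \<mu>_def)
  \<comment> \<open>Tangent line of \<open>\<omega> \<mapsto> 1 / \<omega>\<close> at the barycentre \<open>\<mu>\<close>.\<close>
  have tangent: "2 / \<mu> - \<omega> / \<mu>\<^sup>2 \<le> 1 / \<omega>" if "0 < \<omega>" for \<omega>
  proof -
    have "0 \<le> (\<omega> - \<mu>)\<^sup>2 / (\<omega> * \<mu>\<^sup>2)" using that by simp
    also have "\<dots> = 1 / \<omega> - (2 / \<mu> - \<omega> / \<mu>\<^sup>2)" using that \<mu> by (simp add: field_simps power2_eq_square)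
    finally show ?thesis by simp
  qed
  \<comment> \<open>\<open>P\<close> is the integral of \<open>(U' - \<omega>) (2 / \<mu> - \<omega> / \<mu>\<^sup>2)\<close>.\<close>
  define P where "P u = \<delta> * ((2 / \<mu> - w / \<mu>\<^sup>2) * (a * u - u\<^sup>2 / 2) - \<delta> / \<mu>\<^sup>2 * (a * u\<^sup>2 / 2 - u ^ 3 / 3))" for u
  have "U' * F 0 - 0 - P 0 \<le> U' * F a - a - P a"
  proof (rule DERIV_nonneg_imp_nondecreasing[OF a(1)])
    fix u :: real assume u: "0 \<le> u" "u \<le> a"
    define \<omega> where "\<omega> = w + \<delta> * u"
    have "0 \<le> \<delta> * u" "\<delta> * u \<le> \<delta> * a" using u \<delta> by auto
    then have \<omega>: "0 < \<omega>" "\<omega> \<le> U'" using w0 a(3) by (auto simp: \<omega>_def)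
    have "((\<lambda>u. U' * F u - u - P u) has_real_derivative
        U' * c u - 1 - (U' - \<omega>) * (2 / \<mu> - \<omega> / \<mu>\<^sup>2)) (at u)"
      unfolding P_def a(3) \<omega>_def using \<mu>
      by (auto intro!: derivative_eq_intros F u simp: field_simps power2_eq_square)
    moreover have "(U' - \<omega>) * (2 / \<mu> - \<omega> / \<mu>\<^sup>2) \<le> (U' - \<omega>) * (1 / \<omega>)"
      using tangent[OF \<omega>(1)] \<omega> by (intro mult_left_mono) auto
    moreover have "U' * (1 / \<omega>) \<le> U' * c u"
      using cw[OF u(1)] U'0 by (intro mult_left_mono) (auto simp: \<omega>_def)
    moreover have "(U' - \<omega>) * (1 / \<omega>) = U' * (1 / \<omega>) - 1" using \<omega> by (simp add: field_simps)
    ultimately show "\<exists>z. ((\<lambda>u. U' * F u - u - P u) has_real_derivative z) (at u) \<and> 0 \<le> z"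
      by (intro exI conjI) (assumption, linarith)
  qed
  moreover have "P a = \<delta> * a\<^sup>2 / (2 * \<mu>)"
  proof -
    have w: "w = \<mu> - \<delta> * a / 3" using a(3) by (auto simp: \<mu>_def field_simps)
    show ?thesis unfolding P_def w using \<mu>
      by (simp add: field_simps power2_eq_square power3_eq_cube)
  qed
  ultimately have Fa: "a + \<delta> * a\<^sup>2 / (2 * \<mu>) \<le> U' * F a" by (simp add: F0 P_def)
  have Fy: "(y - a) / U' \<le> F y - F a"
  proof (cases "U' = U")
    case True
    have "F a - a / U \<le> F y - y / U"
    proof (rule DERIV_nonneg_imp_nondecreasing[OF a(2)])
      fix u assume "a \<le> u"
      then have u: "0 \<le> u" using a by simp
      have "((\<lambda>a. F a - a / U) has_real_derivative c u - 1 / U) (at u)"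
        using U' w0 by (auto intro!: derivative_eq_intros F u)
      then show "\<exists>z. ((\<lambda>a. F a - a / U) has_real_derivative z) (at u) \<and> 0 \<le> z"
        using cU[OF u] by force
    qed
    then show ?thesis using True by (simp add: diff_divide_distrib)
  next
    case False
    then have "a = y" using \<delta> by (auto simp: U'_def a_def min_def split: if_splits)
    then show ?thesis by simp
  qed
  define h where "h = F y"
  have "y - a \<le> U' * (h - F a)" using Fy U'0 by (simp add: h_def field_simps)
  then have "y + \<delta> * a\<^sup>2 / (2 * \<mu>) \<le> U' * h" using Fa by (simp add: algebra_simps)
  moreover have "\<delta> * a * h \<le> \<delta> * a\<^sup>2 / (2 * \<mu>) + \<delta> * \<mu> * h\<^sup>2 / 2"
  proof -
    have "0 \<le> \<delta> / (2 * \<mu>) * (a - \<mu> * h)\<^sup>2" using \<delta> \<mu> by simp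
    also have "\<dots> = \<delta> * a\<^sup>2 / (2 * \<mu>) + \<delta> * \<mu> * h\<^sup>2 / 2 - \<delta> * a * h"
      using \<mu> by (simp add: field_simps power2_eq_square)
    finally show ?thesis by simp
  qed
  ultimately have "y - w * h \<le> \<delta> * \<mu> * h\<^sup>2 / 2" unfolding a(3) by (simp add: algebra_simps)
  also have "\<dots> \<le> \<delta> / 6 * (U + 2 * w) * h\<^sup>2"
  proof -
    have "\<delta> * h\<^sup>2 * (U' + 2 * w) \<le> \<delta> * h\<^sup>2 * (U + 2 * w)" using U' \<delta> by (intro mult_left_mono) auto
    then show ?thesis by (simp add: \<mu>_def algebra_simps)
  qed
  finally show ?thesis by (simp add: h_def)
qed

lemma exp_minus_le_quadratic:
  fixes x :: real assumes "0 \<le> x" shows "exp (- x) \<le> 1 - x + x\<^sup>2 / 2"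
proof -
  have "(1 - 0 + 0\<^sup>2 / 2) - exp (- 0) \<le> (1 - x + x\<^sup>2 / 2) - exp (- x :: real)"
  proof (rule DERIV_nonneg_imp_nondecreasing[OF assms])
    fix u :: real
    have "((\<lambda>x. 1 - x + x\<^sup>2 / 2 - exp (- x)) has_real_derivative (- 1 + u + exp (- u))) (at u)"
      by (auto intro!: derivative_eq_intros)
    moreover have "0 \<le> - 1 + u + exp (- u)" using exp_ge_add_one_self[of "- u"] by simp
    ultimately show "\<exists>y. ((\<lambda>x. 1 - x + x\<^sup>2 / 2 - exp (- x)) has_real_derivative y) (at u) \<and> 0 \<le> y"
      by blast
  qed
  then show ?thesis by simp
qed

text \<open>If the slope of the inverse is at least \<open>w - \<delta> u\<close>, then \<open>(w - \<delta> u) exp (\<delta> F u)\<close> is nonincreasing,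
which is Gronwall's inequality for the inverse function.\<close>

lemma secant_remainder_lower:
  fixes F c :: "real \<Rightarrow> real"
  assumes F: "\<And>u. 0 \<le> u \<Longrightarrow> (F has_real_derivative c u) (at u)" and F0: "F 0 = 0"
    and w0: "0 < w" and \<delta>: "0 < \<delta>"
    and c0: "\<And>u. 0 \<le> u \<Longrightarrow> 0 < c u"
    and cw: "\<And>u. 0 \<le> u \<Longrightarrow> (w - \<delta> * u) * c u \<le> 1"
    and y: "0 \<le> y"
  shows "w * F y - y \<le> \<delta> / 2 * w * (F y)\<^sup>2"
proof -
  have "F 0 \<le> F y"
    by (rule DERIV_nonneg_imp_nondecreasing[OF y]) (use F c0 in \<open>force intro: less_imp_le\<close>)
  then have Fy: "0 \<le> F y" by (simp add: F0)
  have "(w - \<delta> * y) * exp (\<delta> * F y) \<le> (w - \<delta> * 0) * exp (\<delta> * F 0)"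
  proof (rule DERIV_nonpos_imp_nonincreasing[OF y])
    fix u :: real assume u: "0 \<le> u"
    have "((\<lambda>y. (w - \<delta> * y) * exp (\<delta> * F y)) has_real_derivative
        \<delta> * exp (\<delta> * F u) * ((w - \<delta> * u) * c u - 1)) (at u)"
      by (auto intro!: derivative_eq_intros F u simp: algebra_simps)
    moreover have "\<delta> * exp (\<delta> * F u) * ((w - \<delta> * u) * c u - 1) \<le> 0"
      using cw[OF u] \<delta> by (intro mult_nonneg_nonpos) auto
    ultimately show "\<exists>z. ((\<lambda>y. (w - \<delta> * y) * exp (\<delta> * F y)) has_real_derivative z) (at u) \<and> z \<le> 0"
      by blast
  qed
  then have "w - \<delta> * y \<le> w * exp (- (\<delta> * F y))" by (simp add: F0 exp_minus field_simps)
  also have "\<dots> \<le> w * (1 - \<delta> * F y + (\<delta> * F y)\<^sup>2 / 2)"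
    using exp_minus_le_quadratic[of "\<delta> * F y"] Fy \<delta> w0 by (intro mult_left_mono) auto
  finally have "\<delta> * (w * F y - y) \<le> \<delta> * (\<delta> / 2 * w * (F y)\<^sup>2)"
    by (simp add: algebra_simps power2_eq_square)
  then show ?thesis using \<delta> by simp
qed

lemma inverse_deriv_remainder_quadratic:
  assumes f: "admissible_cost \<gamma> \<Gamma> \<delta> f" and \<gamma>: "0 < \<gamma>" and \<delta>: "0 < \<delta>"
    and w: "w = 1 / deriv (deriv f) x" and h: "h = deriv f x' - deriv f x"
  shows "\<bar>x' - x - w * h\<bar> \<le> \<delta> / 6 * (1 / \<gamma> + 2 * w) * h\<^sup>2"
proof -
  define c where "c = deriv (deriv f)"
  have c: "\<gamma> \<le> c u" "0 < c u" "c u \<le> \<Gamma>" for u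
    using f \<gamma> by (auto simp: admissible_cost_def c_def intro: less_le_trans)
  have lip: "\<bar>1 / c u - 1 / c v\<bar> \<le> \<delta> * \<bar>u - v\<bar>" for u v
    using f by (simp add: admissible_cost_def c_def)
  have w0: "0 < w" "w \<le> 1 / \<gamma>" using c[of x] \<gamma> by (auto simp: w c_def[symmetric] frac_le)
  have up: "1 / (w + \<delta> * u) \<le> c v" and lo: "(w - \<delta> * u) * c v \<le> 1" if "\<bar>v - x\<bar> = u" for u v
  proof -
    have "\<bar>1 / c v - w\<bar> \<le> \<delta> * u" using lip[of v x] that by (simp add: w c_def)
    then have b: "1 / c v \<le> w + \<delta> * u" "w - \<delta> * u \<le> 1 / c v" by auto
    have p: "0 < w + \<delta> * u" using w0 \<delta> that by (intro add_pos_nonneg) auto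
    show "1 / (w + \<delta> * u) \<le> c v" using b(1) p c(2)[of v] by (simp add: field_simps)
    show "(w - \<delta> * u) * c v \<le> 1" using b(2) c(2)[of v] by (simp add: field_simps)
  qed
  \<comment> \<open>Both directions of displacement are reduced to nonnegative arguments.\<close>
  have main: "\<bar>y - w * F y\<bar> \<le> \<delta> / 6 * (1 / \<gamma> + 2 * w) * (F y)\<^sup>2"
    if F: "\<And>u. 0 \<le> u \<Longrightarrow> (F has_real_derivative c (x + s * u)) (at u)" "F 0 = 0"
      and s: "\<bar>s\<bar> = 1" and y: "0 \<le> y" for F s y
  proof -
    have d: "\<bar>x + s * u - x\<bar> = u" if "0 \<le> u" for u using s that by (simp add: abs_mult)
    have "y - w * F y \<le> \<delta> / 6 * (1 / \<gamma> + 2 * w) * (F y)\<^sup>2"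
      by (rule secant_remainder_upper[OF F w0 \<delta> _ up[OF d] y]) (use c in auto)
    moreover have "w * F y - y \<le> \<delta> / 2 * w * (F y)\<^sup>2"
      by (rule secant_remainder_lower[OF F w0(1) \<delta> _ lo[OF d] y]) (use c in auto)
    moreover have "\<delta> / 2 * w * (F y)\<^sup>2 \<le> \<delta> / 6 * (1 / \<gamma> + 2 * w) * (F y)\<^sup>2"
    proof (intro mult_right_mono)
      have "\<delta> * w \<le> \<delta> * (1 / \<gamma>)" using w0 \<delta> by (intro mult_left_mono) auto
      then show "\<delta> / 2 * w \<le> \<delta> / 6 * (1 / \<gamma> + 2 * w)" by (simp add: algebra_simps)
    qed simp
    ultimately show ?thesis by linarith
  qed
  show ?thesis
  proof (cases "x \<le> x'")
    case True
    have "((\<lambda>u. deriv f (x + u) - deriv f x) has_real_derivative c (x + 1 * u)) (at u)" for u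
      using DERIV_shift[of "deriv f" "c (x + u)" u x] admissible_cost_DERIV(2)[OF f, of "x + u"]
      by (auto intro!: derivative_eq_intros simp: c_def add.commute)
    from main[OF this _ _, of "x' - x"] True show ?thesis by (simp add: h)
  next
    case False
    have "((\<lambda>u. deriv f x - deriv f (x - u)) has_real_derivative c (x + (-1) * u)) (at u)" for u
      by (auto intro!: derivative_eq_intros DERIV_chain2[OF admissible_cost_DERIV(2)[OF f]] simp: c_def)
    from main[OF this _ _, of "x - x'"] False
    have "\<bar>x - x' - w * (deriv f x - deriv f x')\<bar>
        \<le> \<delta> / 6 * (1 / \<gamma> + 2 * w) * (deriv f x - deriv f x')\<^sup>2" by simp
    moreover have "x - x' - w * (deriv f x - deriv f x') = - (x' - x - w * h)"
      by (simp add: h algebra_simps)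
    moreover have "(deriv f x - deriv f x')\<^sup>2 = h\<^sup>2" by (simp add: h power2_commute)
    ultimately show ?thesis by (metis abs_minus_cancel)
  qed
qed

text \<open>The quadratic bound is applied to the first fraction \<open>t\<close> of the way and the linear one, which only
uses that all slopes lie between \<open>1/\<Gamma>\<close> and \<open>1/\<gamma>\<close>, to the rest. Choosing \<open>t < 1\<close> takes the bounded
variation of the slopes into account.\<close>

lemma inverse_deriv_remainder:
  assumes f: "admissible_cost \<gamma> \<Gamma> \<delta> f" and \<gamma>: "0 < \<gamma>" and \<delta>: "0 < \<delta>"
    and w: "w = 1 / deriv (deriv f) x" and h: "h = deriv f x' - deriv f x" and t: "0 \<le> t" "t \<le> 1"
  shows "\<bar>x' - x - w * h\<bar>
      \<le> (1 - t) * (1 / \<gamma> - 1 / \<Gamma>) * \<bar>h\<bar> + t\<^sup>2 * (\<delta> / 6 * (1 / \<gamma> + 2 * w) * h\<^sup>2)"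
proof -
  define z where "z = inv (deriv f) (deriv f x + t * h)"
  have z: "deriv f z = deriv f x + t * h" by (simp add: z_def deriv_cost_inv[OF f \<gamma>])
  have "\<gamma> \<le> deriv (deriv f) x" "deriv (deriv f) x \<le> \<Gamma>" using f by (auto simp: admissible_cost_def)
  then have w': "1 / \<Gamma> \<le> w" "w \<le> 1 / \<gamma>" and \<Gamma>: "0 < \<Gamma>" using \<gamma> by (auto simp: w frac_le)
  define k where "k = (1 - t) * h"
  have k: "k = deriv f x' - deriv f z" by (simp add: k_def z h algebra_simps)
  have "\<bar>z - x - w * (t * h)\<bar> \<le> \<delta> / 6 * (1 / \<gamma> + 2 * w) * (t * h)\<^sup>2"
    by (rule inverse_deriv_remainder_quadratic[OF f \<gamma> \<delta> w]) (simp add: z)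
  moreover have "\<bar>x' - z - w * k\<bar> \<le> (1 / \<gamma> - 1 / \<Gamma>) * \<bar>k\<bar>"
  proof (cases "z \<le> x'")
    case True
    have b: "k / \<Gamma> \<le> x' - z" "x' - z \<le> k / \<gamma>"
      using deriv_cost_growth[OF f True] \<gamma> \<Gamma> by (auto simp: k field_simps)
    have "0 \<le> k" using deriv_cost_growth(1)[OF f True] True \<gamma> unfolding k
      by (smt (verit) mult_nonneg_nonneg)
    moreover have "k / \<Gamma> \<le> w * k" "w * k \<le> k / \<gamma>"
      using mult_right_mono[OF w'(1) \<open>0 \<le> k\<close>] mult_right_mono[OF w'(2) \<open>0 \<le> k\<close>] by auto
    ultimately show ?thesis using b by (simp add: algebra_simps abs_le_iff)
  next
    case False
    then have zx: "x' \<le> z" by simp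
    have b: "x' - z \<le> k / \<Gamma>" "k / \<gamma> \<le> x' - z"
      using deriv_cost_growth[OF f zx] \<gamma> \<Gamma> by (auto simp: k field_simps)
    have "k \<le> 0" using deriv_cost_growth(1)[OF f zx] zx \<gamma> unfolding k
      by (smt (verit) mult_nonneg_nonneg)
    moreover have "w * k \<le> k / \<Gamma>" "k / \<gamma> \<le> w * k"
      using mult_right_mono_neg[OF w'(1) \<open>k \<le> 0\<close>] mult_right_mono_neg[OF w'(2) \<open>k \<le> 0\<close>] by auto
    ultimately show ?thesis using b by (simp add: algebra_simps abs_le_iff)
  qed
  moreover have "x' - x - w * h = (z - x - w * (t * h)) + (x' - z - w * k)"
    by (simp add: k_def algebra_simps)
  moreover have "\<bar>k\<bar> = (1 - t) * \<bar>h\<bar>" using t by (simp add: k_def abs_mult)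
  moreover have "\<delta> / 6 * (1 / \<gamma> + 2 * w) * (t * h)\<^sup>2 = t\<^sup>2 * (\<delta> / 6 * (1 / \<gamma> + 2 * w) * h\<^sup>2)"
    by (simp add: power_mult_distrib)
  moreover have "(1 / \<gamma> - 1 / \<Gamma>) * \<bar>k\<bar> = (1 - t) * (1 / \<gamma> - 1 / \<Gamma>) * \<bar>h\<bar>"
    unfolding \<open>\<bar>k\<bar> = (1 - t) * \<bar>h\<bar>\<close> by simp
  ultimately show ?thesis by linarith
qed

section \<open>The Laplacian and one step of the dual iteration\<close>

lemma incidence_transpose_mult:
  fixes G :: "('n::finite, 'e::finite) pre_digraph"
  assumes "tail G e \<noteq> head G e"
  shows "(u v* incidence_matrix G) $ e = u $ tail G e - u $ head G e"
proof -
  have "(u v* incidence_matrix G) $ e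
      = (\<Sum>i\<in>UNIV. (if tail G e = i then u $ i else 0) - (if head G e = i then u $ i else 0))"
    unfolding vector_matrix_mult_def incidence_matrix_def
    by (use assms assms[symmetric] in \<open>auto intro!: sum.cong\<close>)
  then show ?thesis by (simp add: sum_subtractf)
qed

lemma norm_incidence_column:
  fixes G :: "('n::finite, 'e::finite) pre_digraph"
  assumes "tail G e \<noteq> head G e"
  shows "norm (column e (incidence_matrix G)) = sqrt 2"
proof -
  have "(norm (column e (incidence_matrix G)))\<^sup>2
      = (\<Sum>i\<in>UNIV. (if tail G e = i then 1 else 0) + (if head G e = i then 1 else 0))"
    unfolding norm_vec_sq column_def incidence_matrix_def
    by (rule sum.cong) (use assms in auto)
  also have "\<dots> = 2" by (simp add: sum.distrib)
  finally show ?thesis by (metis norm_ge_zero real_sqrt_unique)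
qed

lemma laplacian_bounds:
  fixes G :: "('n::finite, 'e::finite) pre_digraph"
  assumes loopfree: "\<And>e. tail G e \<noteq> head G e" and pos: "0 < kth_eigenvalue (laplacian G) 2"
  defines "A \<equiv> incidence_matrix G"
  shows "(\<chi> i. 1) v* A = 0"
    and "(\<Sum>i\<in>UNIV. u $ i) = 0 \<Longrightarrow> kth_eigenvalue (laplacian G) 2 * (norm u)\<^sup>2 \<le> (norm (u v* A))\<^sup>2"
    and "norm (u v* A) \<le> sqrt (kth_eigenvalue (laplacian G) CARD('n)) * norm u"
    and "kth_eigenvalue (laplacian G) 2 \<le> kth_eigenvalue (laplacian G) CARD('n)"
proof -
  let ?\<mu>2 = "kth_eigenvalue (laplacian G) 2"
  let ?\<mu>n = "kth_eigenvalue (laplacian G) CARD('n)"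
  show one: "(\<chi> i. 1) v* A = 0"
    by (simp add: vec_eq_iff A_def incidence_transpose_mult loopfree)
  have L: "laplacian G *v u = A *v (u v* A)" for u
    by (simp add: laplacian_def A_def matrix_vector_mul_assoc[symmetric])
  have L1: "laplacian G *v (\<chi> i. 1) = 0" by (simp add: L one)
  have uL: "u \<bullet> (laplacian G *v u) = (norm (u v* A))\<^sup>2" for u
    by (simp add: L dot_lmul_matrix[symmetric] power2_norm_eq_inner)
  have sym: "transpose (laplacian G) = laplacian G"
    by (simp add: laplacian_def matrix_transpose_mul)
  have lower: "?\<mu>2 * (norm u)\<^sup>2 \<le> (norm (u v* A))\<^sup>2" if "(\<Sum>i\<in>UNIV. u $ i) = 0" for u
    using second_eigenvalue_le_rayleigh[OF sym L1 pos that] unfolding uL by (simp add: power2_norm_eq_inner)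
  then show "(\<Sum>i\<in>UNIV. u $ i) = 0 \<Longrightarrow> ?\<mu>2 * (norm u)\<^sup>2 \<le> (norm (u v* A))\<^sup>2" .
  have upper: "(norm (u v* A))\<^sup>2 \<le> ?\<mu>n * (norm u)\<^sup>2" for u
    using rayleigh_le_largest_eigenvalue[OF sym, of u] by (simp add: uL power2_norm_eq_inner)
  show "norm (u v* A) \<le> sqrt ?\<mu>n * norm u"
    using real_sqrt_le_mono[OF upper[of u]] by (simp add: real_sqrt_mult)
  fix e0 :: 'e
  define z :: "real ^ 'n" where "z = axis (tail G e0) 1 - axis (head G e0) 1"
  have "z $ tail G e0 = 1" using loopfree by (simp add: z_def axis_def)
  then have "0 < (norm z)\<^sup>2" by auto
  moreover have "(\<Sum>i\<in>UNIV. z $ i) = 0" by (simp add: z_def sum_subtractf axis_def)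
  then have "?\<mu>2 * (norm z)\<^sup>2 \<le> ?\<mu>n * (norm z)\<^sup>2" using lower upper order_trans by blast
  ultimately show "?\<mu>2 \<le> ?\<mu>n" by (simp add: mult_le_cancel_right)
qed

text \<open>Both parts are edgewise. The dual function is a sum of convex conjugates of the edge costs minus a
linear term, and the gradient moves by \<open>A\<close> applied to the change of the flow, of which \<open>r\<close> is the
part that the linearization misses.\<close>

lemma dual_step:
  fixes G :: "('n::finite, 'e::finite) pre_digraph" and b u l :: "real ^ 'n"
  assumes loopfree: "\<And>e. tail G e \<noteq> head G e" and \<gamma>: "0 < \<gamma>" "\<gamma> \<le> \<Gamma>" and \<delta>: "0 < \<delta>"
    and \<Phi>: "\<And>e. admissible_cost \<gamma> \<Gamma> \<delta> (\<Phi> e)"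
  defines "A \<equiv> incidence_matrix G"
    and "w \<equiv> \<chi> e. 1 / deriv (deriv (\<Phi> e)) (flow G \<Phi> l $ e)"
  shows "dual G \<Phi> b (l + u) - dual G \<Phi> b l \<le> u \<bullet> dual_gradient G \<Phi> b l + (norm (u v* A))\<^sup>2 / (2 * \<gamma>)"
    and "\<exists>r. dual_gradient G \<Phi> b (l + u) = dual_gradient G \<Phi> b l + dual_hessian G \<Phi> l *v u + A *v r \<and>
      (\<forall>e t. 0 \<le> t \<longrightarrow> t \<le> 1 \<longrightarrow> \<bar>r $ e\<bar> \<le> (1 - t) * (1 / \<gamma> - 1 / \<Gamma>) * \<bar>(u v* A) $ e\<bar>
          + t\<^sup>2 * (\<delta> / 6 * (1 / \<gamma> + 2 * w $ e) * ((u v* A) $ e)\<^sup>2))"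
proof -
  define x where "x = flow G \<Phi> l"
  define x' where "x' = flow G \<Phi> (l + u)"
  define s where "s = l v* A"
  define h where "h = u v* A"
  have s_e: "s $ e = l $ tail G e - l $ head G e" for e
    by (simp add: s_def A_def incidence_transpose_mult[OF loopfree])
  have h_e: "h $ e = u $ tail G e - u $ head G e" for e
    by (simp add: h_def A_def incidence_transpose_mult[OF loopfree])
  have x_e: "deriv (\<Phi> e) (x $ e) = s $ e" for e
    by (simp add: x_def flow_def s_e deriv_cost_inv[OF \<Phi> \<gamma>(1)])
  have x'_e: "deriv (\<Phi> e) (x' $ e) = s $ e + h $ e" for e
    by (simp add: x'_def flow_def s_e h_e deriv_cost_inv[OF \<Phi> \<gamma>(1)])
  have "dual G \<Phi> b l = (\<Sum>e\<in>UNIV. s $ e * x $ e - \<Phi> e (x $ e)) - l \<bullet> b"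
    unfolding dual_def A_def[symmetric] x_def[symmetric] inner_diff_right dot_lmul_matrix[symmetric] s_def[symmetric]
    by (simp add: inner_vec_def sum_subtractf)
  moreover have "dual G \<Phi> b (l + u) = (\<Sum>e\<in>UNIV. (s + h) $ e * x' $ e - \<Phi> e (x' $ e)) - (l + u) \<bullet> b"
  proof -
    have "(l + u) v* A = s + h" unfolding s_def h_def by (simp add: vector_matrix_left_distrib)
    then show ?thesis
      unfolding dual_def A_def[symmetric] x'_def[symmetric] inner_diff_right dot_lmul_matrix[symmetric]
      by (simp add: inner_vec_def sum_subtractf)
  qed
  moreover have "(s + h) $ e * x' $ e - \<Phi> e (x' $ e) - (s $ e * x $ e - \<Phi> e (x $ e))
      \<le> h $ e * x $ e + (h $ e)\<^sup>2 / (2 * \<gamma>)" for e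
    using conjugate_cost_smooth[OF \<Phi> \<gamma>(1), of e "x' $ e" "x $ e"]
    by (simp add: x_e x'_e algebra_simps)
  then have "(\<Sum>e\<in>UNIV. (s + h) $ e * x' $ e - \<Phi> e (x' $ e)) - (\<Sum>e\<in>UNIV. s $ e * x $ e - \<Phi> e (x $ e))
      \<le> (\<Sum>e\<in>UNIV. h $ e * x $ e + (h $ e)\<^sup>2 / (2 * \<gamma>))"
    unfolding sum_subtractf[symmetric] by (intro sum_mono)
  moreover have "(\<Sum>e\<in>UNIV. h $ e * x $ e + (h $ e)\<^sup>2 / (2 * \<gamma>)) = h \<bullet> x + (norm h)\<^sup>2 / (2 * \<gamma>)"
    by (simp add: sum.distrib inner_vec_def norm_vec_sq sum_divide_distrib)
  moreover have "u \<bullet> dual_gradient G \<Phi> b l = h \<bullet> x - u \<bullet> b"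
    by (simp add: dual_gradient_def A_def[symmetric] x_def[symmetric] inner_diff_right dot_lmul_matrix[symmetric] h_def)
  ultimately show "dual G \<Phi> b (l + u) - dual G \<Phi> b l
      \<le> u \<bullet> dual_gradient G \<Phi> b l + (norm (u v* A))\<^sup>2 / (2 * \<gamma>)"
    by (simp add: h_def[symmetric] inner_add_left)
  define r where "r = (\<chi> e. x' $ e - x $ e - w $ e * h $ e)"
  have "x' = x + (\<chi> e. w $ e * h $ e) + r" by (simp add: r_def vec_eq_iff)
  then have "A *v x' = A *v x + A *v (\<chi> e. w $ e * h $ e) + A *v r"
    by (simp add: matrix_vector_right_distrib)
  moreover have "dual_hessian G \<Phi> l *v u = A *v (\<chi> e. w $ e * h $ e)"
    unfolding dual_hessian_def A_def[symmetric] w_def[symmetric] weighted_gram_mult h_def ..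
  ultimately have "dual_gradient G \<Phi> b (l + u) = dual_gradient G \<Phi> b l + dual_hessian G \<Phi> l *v u + A *v r"
    by (simp add: dual_gradient_def A_def[symmetric] x_def[symmetric] x'_def[symmetric])
  moreover have "\<bar>r $ e\<bar> \<le> (1 - t) * (1 / \<gamma> - 1 / \<Gamma>) * \<bar>h $ e\<bar> + t\<^sup>2 * (\<delta> / 6 * (1 / \<gamma> + 2 * w $ e) * (h $ e)\<^sup>2)"
    if "0 \<le> t" "t \<le> 1" for e t
    using inverse_deriv_remainder[OF \<Phi> \<gamma>(1) \<delta> _ _ that, of "w $ e" e "x $ e" "h $ e" "x' $ e"]
    by (simp add: r_def w_def x_def[symmetric] x_e x'_e)
  ultimately show "\<exists>r. dual_gradient G \<Phi> b (l + u) = dual_gradient G \<Phi> b l + dual_hessian G \<Phi> l *v u + A *v r \<and>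
      (\<forall>e t. 0 \<le> t \<longrightarrow> t \<le> 1 \<longrightarrow> \<bar>r $ e\<bar> \<le> (1 - t) * (1 / \<gamma> - 1 / \<Gamma>) * \<bar>(u v* A) $ e\<bar>
          + t\<^sup>2 * (\<delta> / 6 * (1 / \<gamma> + 2 * w $ e) * ((u v* A) $ e)\<^sup>2))"
    unfolding h_def[symmetric] by blast
qed

section \<open>Approximate Newton steps\<close>

text \<open>Cauchy--Schwarz for the indefinite form \<open>q\<close> given by \<open>H Z H - c H\<close>, whose absolute value is at most
\<open>\<sigma>\<close> times the form of \<open>H\<close>: the left-hand side is the polar form of \<open>q\<close> at \<open>f\<close> and \<open>d\<close>, and the polar
identity is used with \<open>f \<plusminus> \<sigma> d\<close>.\<close>

lemma newton_error_le:
  fixes H Z :: "real ^ 'n::finite ^ 'n"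
  assumes H: "\<And>u v. u \<bullet> (H *v v) = v \<bullet> (H *v u)" and Z: "transpose Z = Z" and \<sigma>: "0 < \<sigma>"
    and bd: "\<And>u. \<bar>(H *v u) \<bullet> (Z *v (H *v u)) - c * (u \<bullet> (H *v u))\<bar> \<le> \<sigma> * (u \<bullet> (H *v u))"
    and d: "H *v d = - g" and f: "f = - (Z *v g) - c *\<^sub>R d"
  shows "f \<bullet> (H *v f) \<le> \<sigma>\<^sup>2 * (d \<bullet> (H *v d))"
proof -
  define q where "q u = (H *v u) \<bullet> (Z *v (H *v u)) - c * (u \<bullet> (H *v u))" for u
  define x where "x = (H *v f) \<bullet> (Z *v (H *v d)) - c * (f \<bullet> (H *v d))"
  note lin = matrix_vector_right_distrib matrix_vector_mult_scaleR inner_add_left inner_add_right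
    matrix_vector_mult_diff_distrib inner_diff_left inner_diff_right
  have ZH: "(H *v d) \<bullet> (Z *v (H *v f)) = (H *v f) \<bullet> (Z *v (H *v d))"
    by (metis inner_commute inner_symmetric_matrix[OF Z])
  have "f = Z *v (H *v d) - c *\<^sub>R d" 
    using matrix_vector_mult_scaleR[of Z "-1" g] by (simp add: f d)
  then have fx: "f \<bullet> (H *v f) = x"
    by (metis H inner_commute inner_diff_right inner_scaleR_right x_def)
  have "q (f + \<sigma> *\<^sub>R d) - q (f - \<sigma> *\<^sub>R d) = 4 * \<sigma> * x"
    unfolding q_def x_def using ZH H[of d f] by (simp add: lin algebra_simps)
  moreover have "q (f + \<sigma> *\<^sub>R d) \<le> \<sigma> * ((f + \<sigma> *\<^sub>R d) \<bullet> (H *v (f + \<sigma> *\<^sub>R d)))"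
    and "- q (f - \<sigma> *\<^sub>R d) \<le> \<sigma> * ((f - \<sigma> *\<^sub>R d) \<bullet> (H *v (f - \<sigma> *\<^sub>R d)))"
    using bd[of "f + \<sigma> *\<^sub>R d"] bd[of "f - \<sigma> *\<^sub>R d"] by (auto simp: q_def)
  moreover have "(f + \<sigma> *\<^sub>R d) \<bullet> (H *v (f + \<sigma> *\<^sub>R d)) + (f - \<sigma> *\<^sub>R d) \<bullet> (H *v (f - \<sigma> *\<^sub>R d))
      = 2 * (x + \<sigma>\<^sup>2 * (d \<bullet> (H *v d)))"
    by (simp add: lin fx[symmetric] power2_eq_square algebra_simps)
  ultimately have "4 * \<sigma> * x \<le> \<sigma> * (2 * (x + \<sigma>\<^sup>2 * (d \<bullet> (H *v d))))"
    by (smt (verit) distrib_left)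
  then have "4 * x \<le> 2 * (x + \<sigma>\<^sup>2 * (d \<bullet> (H *v d)))" using \<sigma> by (simp add: algebra_simps)
  then show ?thesis by (simp add: fx)
qed

text \<open>Here \<open>N\<close> is the norm \<open>\<parallel>d\<parallel>\<close> of the exact Newton direction in the seminorm of \<open>H\<close>. The last two
estimates of the linear part of the new gradient differ in the point that \<open>d'\<close> is compared with:
the exact direction \<open>d\<close>, by the error bound of the solver, or its multiple by the midpoint \<open>1 + \<epsilon>\<^sup>4/2\<close> of
\<open>1 - \<epsilon>\<^sup>2\<close> and \<open>1 + \<epsilon>\<^sup>2 + \<epsilon>\<^sup>4\<close>, which enclose the spectrum of \<open>Z\<close> relative to the pseudo-inverse.\<close>

lemma approx_newton_step:
  fixes A :: "real ^ 'e::finite ^ 'n::finite" and w :: "real ^ 'e" and g d' :: "real ^ 'n"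
  defines "H \<equiv> A ** diag_matrix w ** transpose A"
  assumes one: "(\<chi> i. 1) v* A = 0"
    and lb: "\<And>u. (\<Sum>i\<in>UNIV. u $ i) = 0 \<Longrightarrow> \<mu>2 * (norm u)\<^sup>2 \<le> (norm (u v* A))\<^sup>2" and \<mu>2: "0 < \<mu>2"
    and ub: "\<And>u. norm (u v* A) \<le> sqrt \<mu>n * norm u" and \<mu>n: "0 < \<mu>n"
    and \<gamma>: "0 < \<gamma>" "\<gamma> \<le> \<Gamma>" and w: "\<And>e. 1 / \<Gamma> \<le> w $ e" "\<And>e. w $ e \<le> 1 / \<gamma>"
    and \<epsilon>: "0 < \<epsilon>" "\<epsilon> < 1" and d': "approx_newton_direction \<epsilon> H g d'"
  defines "M \<equiv> \<mu>n / \<mu>2 * sqrt (\<Gamma> / \<gamma>)"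
  obtains N where "0 \<le> N" "N \<le> sqrt \<Gamma> / \<mu>2 * norm (g v* A)" "\<gamma> / \<mu>n\<^sup>2 * (norm (g v* A))\<^sup>2 \<le> N\<^sup>2"
    "mat_norm H d' \<le> (1 + \<epsilon>) * N" "d' \<bullet> g \<le> - (exp (- (\<epsilon>\<^sup>2)) * N\<^sup>2)"
    "\<And>\<alpha>. 0 \<le> \<alpha> \<Longrightarrow> \<alpha> \<le> 1 \<Longrightarrow>
      norm ((g + \<alpha> *\<^sub>R (H *v d')) v* A) \<le> (1 - \<alpha> + \<alpha> * \<epsilon> * M) * norm (g v* A)"
    "\<And>\<alpha>. 0 \<le> \<alpha> \<Longrightarrow> \<alpha> * (1 + \<epsilon> ^ 4 / 2) \<le> 1 \<Longrightarrow>
      norm ((g + \<alpha> *\<^sub>R (H *v d')) v* A)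
        \<le> (1 - \<alpha> * (1 + \<epsilon> ^ 4 / 2) + \<alpha> * M * (\<epsilon>\<^sup>2 + \<epsilon> ^ 4 / 2)) * norm (g v* A)"
proof -
  define c where "c = 1 + \<epsilon> ^ 4 / 2"
  define \<sigma> where "\<sigma> = \<epsilon>\<^sup>2 + \<epsilon> ^ 4 / 2"
  define G where "G = norm (g v* A)"
  have \<Gamma>: "0 < \<Gamma>" using \<gamma> by simp
  then have l: "0 < 1 / \<Gamma>" by simp
  have w0: "0 \<le> w $ e" for e using w(1)[of e] l by linarith
  note mn2 = mat_norm_weighted_gram[OF w0, of A, folded H_def]
  have mn0: "0 \<le> mat_norm H u" for u
    unfolding H_def mat_norm_weighted_gram_eq_norm[OF w0] by simp
  obtain d Z where d: "H *v d = - g" and err: "mat_norm H (d' - d) \<le> \<epsilon> * mat_norm H d"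
    and Z: "transpose Z = Z" "d' = - (Z *v g)"
    and Zb: "\<And>v. (\<Sum>i\<in>UNIV. v $ i) = 0 \<Longrightarrow>
           exp (- (\<epsilon>\<^sup>2)) * (v \<bullet> (pseudo_inverse H *v v)) \<le> v \<bullet> (Z *v v) \<and>
           v \<bullet> (Z *v v) \<le> exp (\<epsilon>\<^sup>2) * (v \<bullet> (pseudo_inverse H *v v))"
    using d' unfolding approx_newton_direction_def by blast
  define N where "N = mat_norm H d"
  have sumH: "(\<Sum>i\<in>UNIV. (H *v u) $ i) = 0" for u
  proof -
    have "(\<Sum>i\<in>UNIV. (H *v u) $ i) = (\<chi> i. 1) \<bullet> (H *v u)" by (simp add: inner_vec_def)
    also have "\<dots> = 0" unfolding H_def weighted_gram_inner one by simp
    finally show ?thesis .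
  qed
  have g0: "(\<Sum>i\<in>UNIV. g $ i) = 0" using sumH[of d] by (simp add: d sum_negf)
  \<comment> \<open>On the range of \<open>H\<close> the form of the pseudo-inverse is that of \<open>H\<close> itself.\<close>
  have form: "(H *v u) \<bullet> (pseudo_inverse H *v (H *v u)) = u \<bullet> (H *v u)" for u
  proof -
    have "H ** pseudo_inverse H ** H = H"
      unfolding H_def by (rule pseudo_inverse_weighted_gram[OF one lb \<mu>2 w(1) l])
    then have "u \<bullet> (H *v (pseudo_inverse H *v (H *v u))) = u \<bullet> (H *v u)"
      by (simp add: matrix_vector_mul_assoc matrix_mul_assoc)
    moreover have "u \<bullet> (H *v v) = (H *v u) \<bullet> v" for v
      unfolding H_def by (metis inner_commute weighted_gram_symmetric)
    ultimately show ?thesis by simp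
  qed
  have Zform: "exp (- (\<epsilon>\<^sup>2)) * (mat_norm H u)\<^sup>2 \<le> (H *v u) \<bullet> (Z *v (H *v u))"
    "(H *v u) \<bullet> (Z *v (H *v u)) \<le> exp (\<epsilon>\<^sup>2) * (mat_norm H u)\<^sup>2" for u
    using Zb[OF sumH, of u] by (auto simp: form mn2(2))
  have Nle: "N \<le> sqrt \<Gamma> / \<mu>2 * G"
  proof -
    have "1 / \<Gamma> * \<mu>2 * N\<^sup>2 \<le> (norm g)\<^sup>2"
      unfolding N_def H_def by (rule newton_decrement_le[OF one lb \<mu>2 w(1) l d[unfolded H_def]])
    then have "\<mu>2 * (1 / \<Gamma> * \<mu>2 * N\<^sup>2) \<le> G\<^sup>2"
      using lb[OF g0] \<mu>2 unfolding G_def by (meson less_imp_le mult_left_mono order_trans)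
    then have "N\<^sup>2 \<le> (sqrt \<Gamma> / \<mu>2 * G)\<^sup>2"
      using \<mu>2 \<Gamma> by (simp add: power_mult_distrib power_divide field_simps power2_eq_square)
    moreover have "0 \<le> sqrt \<Gamma> / \<mu>2 * G" using \<mu>2 \<Gamma> by (simp add: G_def)
    ultimately show ?thesis by (rule power2_le_imp_le)
  qed
  have Hf: "norm ((H *v f) v* A) \<le> M * \<tau> * G" if "mat_norm H f \<le> \<tau> * N" "0 \<le> \<tau>" for f \<tau>
  proof -
    have "norm ((H *v f) v* A) \<le> sqrt \<mu>n * norm (H *v f)" by (rule ub)
    also have "\<dots> \<le> sqrt \<mu>n * (sqrt \<mu>n * sqrt (1 / \<gamma>) * mat_norm H f)"
      unfolding H_def using \<mu>n by (intro mult_left_mono norm_weighted_gram_le[OF ub _ w0 w(2)]) auto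
    also have "\<dots> = \<mu>n * sqrt (1 / \<gamma>) * mat_norm H f" using \<mu>n by simp
    also have "\<dots> \<le> \<mu>n * sqrt (1 / \<gamma>) * (\<tau> * (sqrt \<Gamma> / \<mu>2 * G))"
      using that Nle \<mu>n \<gamma> by (intro mult_left_mono order_trans[OF that(1)]) auto
    also have "\<dots> = M * \<tau> * G" using \<gamma> by (simp add: M_def real_sqrt_divide mult_ac)
    finally show ?thesis .
  qed
  have lin: "norm ((g + \<alpha> *\<^sub>R (H *v d')) v* A) \<le> (1 - \<alpha> * k + \<alpha> * M * \<tau>) * G"
    if "0 \<le> \<alpha>" "\<alpha> * k \<le> 1" "mat_norm H (d' - k *\<^sub>R d) \<le> \<tau> * N" "0 \<le> \<tau>" for \<alpha> k \<tau>
  proof -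
    have sc: "(r *\<^sub>R v) v* A = r *\<^sub>R (v v* A)" for r v
      by (metis matrix_vector_mult_scaleR transpose_matrix_vector)
    have "g + \<alpha> *\<^sub>R (H *v d') = (1 - \<alpha> * k) *\<^sub>R g + \<alpha> *\<^sub>R (H *v (d' - k *\<^sub>R d))"
      by (simp add: matrix_vector_mult_diff_distrib matrix_vector_mult_scaleR d algebra_simps)
    then have "(g + \<alpha> *\<^sub>R (H *v d')) v* A
        = (1 - \<alpha> * k) *\<^sub>R (g v* A) + \<alpha> *\<^sub>R ((H *v (d' - k *\<^sub>R d)) v* A)"
      by (simp add: vector_matrix_left_distrib sc)
    also have "norm \<dots> \<le> (1 - \<alpha> * k) * G + \<alpha> * norm ((H *v (d' - k *\<^sub>R d)) v* A)"
      using that by (intro norm_triangle_le) (simp add: G_def)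
    also have "\<dots> \<le> (1 - \<alpha> * k) * G + \<alpha> * (M * \<tau> * G)"
      using Hf[OF that(3,4)] that(1) by (intro add_left_mono mult_left_mono)
    finally show ?thesis by (simp add: algebra_simps)
  qed
  have err2: "mat_norm H (d' - c *\<^sub>R d) \<le> \<sigma> * N"
  proof -
    have sig: "0 < \<sigma>" using \<epsilon> by (simp add: \<sigma>_def add_pos_pos)
    have "\<epsilon>\<^sup>2 \<le> 1" using \<epsilon> by (simp add: power_le_one)
    then have "exp (\<epsilon>\<^sup>2) \<le> 1 + \<epsilon>\<^sup>2 + (\<epsilon>\<^sup>2)\<^sup>2" by (intro exp_bound) auto
    then have up: "exp (\<epsilon>\<^sup>2) \<le> c + \<sigma>" by (simp add: c_def \<sigma>_def)
    have lo: "c - \<sigma> \<le> exp (- (\<epsilon>\<^sup>2))"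
      using exp_ge_add_one_self[of "- (\<epsilon>\<^sup>2)"] by (simp add: c_def \<sigma>_def)
    have "\<bar>(H *v u) \<bullet> (Z *v (H *v u)) - c * (u \<bullet> (H *v u))\<bar> \<le> \<sigma> * (u \<bullet> (H *v u))" for u
    proof -
      have "(c - \<sigma>) * (mat_norm H u)\<^sup>2 \<le> exp (- (\<epsilon>\<^sup>2)) * (mat_norm H u)\<^sup>2"
        "exp (\<epsilon>\<^sup>2) * (mat_norm H u)\<^sup>2 \<le> (c + \<sigma>) * (mat_norm H u)\<^sup>2"
        using lo up by (intro mult_right_mono; simp)+
      then show ?thesis using Zform[of u] unfolding mn2(2)[symmetric]
        by (simp add: abs_le_iff algebra_simps)
    qed
    moreover have "u \<bullet> (H *v v) = v \<bullet> (H *v u)" for u v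
      unfolding H_def by (rule weighted_gram_symmetric)
    ultimately have "(d' - c *\<^sub>R d) \<bullet> (H *v (d' - c *\<^sub>R d)) \<le> \<sigma>\<^sup>2 * (d \<bullet> (H *v d))"
      by (intro newton_error_le[where Z = Z and g = g and c = c] Z sig d) (auto simp: Z(2))
    then have "(mat_norm H (d' - c *\<^sub>R d))\<^sup>2 \<le> (\<sigma> * N)\<^sup>2"
      by (simp add: mn2(2)[symmetric] N_def power_mult_distrib)
    then show ?thesis by (rule power2_le_imp_le) (use sig mn0 in \<open>simp add: N_def\<close>)
  qed
  show thesis
  proof (rule that[of N])
    show N0: "0 \<le> N" by (simp add: N_def mn0)
    show "N \<le> sqrt \<Gamma> / \<mu>2 * norm (g v* A)" using Nle by (simp add: G_def)
    have "norm g \<le> sqrt \<mu>n * sqrt (1 / \<gamma>) * N"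
      using norm_weighted_gram_le[OF ub _ w0 w(2), of d] \<mu>n d by (simp add: N_def H_def)
    then have "sqrt \<mu>n * norm g \<le> sqrt \<mu>n * (sqrt \<mu>n * sqrt (1 / \<gamma>) * N)"
      using \<mu>n by (intro mult_left_mono) auto
    also have "\<dots> = \<mu>n * sqrt (1 / \<gamma>) * N" using \<mu>n by simp
    finally have "G \<le> \<mu>n * sqrt (1 / \<gamma>) * N" using ub[of g] unfolding G_def by linarith
    then have "G\<^sup>2 \<le> (\<mu>n * sqrt (1 / \<gamma>) * N)\<^sup>2" by (intro power_mono) (auto simp: G_def)
    then show "\<gamma> / \<mu>n\<^sup>2 * (norm (g v* A))\<^sup>2 \<le> N\<^sup>2"
      using \<gamma> \<mu>n by (simp add: G_def power_mult_distrib field_simps)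
    show "mat_norm H d' \<le> (1 + \<epsilon>) * N"
      using mat_norm_weighted_gram_triangle[OF w0, of A d' d] err
      by (simp add: H_def N_def algebra_simps)
    show "d' \<bullet> g \<le> - (exp (- (\<epsilon>\<^sup>2)) * N\<^sup>2)"
    proof -
      have "Z *v (- g) = - (Z *v g)" using matrix_vector_mult_scaleR[of Z "-1" g] by simp
      then show ?thesis using Zform(1)[of d] by (simp add: d Z(2) N_def inner_commute)
    qed
    show "norm ((g + \<alpha> *\<^sub>R (H *v d')) v* A) \<le> (1 - \<alpha> + \<alpha> * \<epsilon> * M) * norm (g v* A)"
      if "0 \<le> \<alpha>" "\<alpha> \<le> 1" for \<alpha>
      using lin[of \<alpha> 1 \<epsilon>] that err \<epsilon> by (simp add: N_def G_def algebra_simps)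
    show "norm ((g + \<alpha> *\<^sub>R (H *v d')) v* A)
        \<le> (1 - \<alpha> * (1 + \<epsilon> ^ 4 / 2) + \<alpha> * M * (\<epsilon>\<^sup>2 + \<epsilon> ^ 4 / 2)) * norm (g v* A)"
      if "0 \<le> \<alpha>" "\<alpha> * (1 + \<epsilon> ^ 4 / 2) \<le> 1" for \<alpha>
      using lin[of \<alpha> c \<sigma>] that err2 \<epsilon> by (simp add: c_def \<sigma>_def G_def)
  qed
qed

text \<open>The linear parts of the edge remainders are collected in the Euclidean norm and the quadratic parts in
the \<open>\<ell>\<^sup>1\<close>-norm. In the quadratic parts \<open>1/\<gamma> + 2 w\<close> is at most \<open>(\<kappa> + 2) w\<close>, so that their
sum is at most \<open>\<kappa> + 2\<close> times the square of the seminorm of \<open>H\<close>; with \<open>3/\<gamma>\<close> instead of \<open>1/\<gamma> + 2 w\<close> the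
factor would be \<open>3 \<kappa>\<close>.\<close>

lemma gradient_remainder_bound:
  fixes A :: "real ^ 'e::finite ^ 'n::finite" and w r :: "real ^ 'e" and u :: "real ^ 'n"
  defines "H \<equiv> A ** diag_matrix w ** transpose A"
  assumes ub: "\<And>u. norm (u v* A) \<le> sqrt \<mu>n * norm u" and \<mu>n: "0 < \<mu>n"
    and col: "\<And>e. norm (column e A) \<le> sqrt 2"
    and \<gamma>: "0 < \<gamma>" "\<gamma> \<le> \<Gamma>" and \<delta>: "0 < \<delta>" and w: "\<And>e. 1 / \<Gamma> \<le> w $ e"
    and t: "0 \<le> t" "t \<le> 1"
    and r: "\<And>e. \<bar>r $ e\<bar> \<le> (1 - t) * (1 / \<gamma> - 1 / \<Gamma>) * \<bar>(u v* A) $ e\<bar>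
          + t\<^sup>2 * (\<delta> / 6 * (1 / \<gamma> + 2 * w $ e) * ((u v* A) $ e)\<^sup>2)"
    and N: "mat_norm H u \<le> N"
  shows "norm ((A *v r) v* A) \<le> (1 - t) * (\<mu>n * (1 / \<gamma> - 1 / \<Gamma>) * sqrt \<Gamma>) * N
      + t\<^sup>2 * (sqrt \<mu>n * sqrt 2 * (\<delta> / 6) * (\<Gamma> / \<gamma> + 2)) * N\<^sup>2"
proof -
  have \<Gamma>: "0 < \<Gamma>" using \<gamma> by simp
  have w0: "0 < w $ e" for e using w[of e] \<Gamma> by (meson divide_pos_pos less_le_trans zero_less_one)
  define h where "h = u v* A"
  define a :: "real ^ 'e" where "a = (\<chi> e. (1 - t) * (1 / \<gamma> - 1 / \<Gamma>) * \<bar>h $ e\<bar>)"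
  define b where "b e = t\<^sup>2 * (\<delta> / 6 * (1 / \<gamma> + 2 * w $ e) * (h $ e)\<^sup>2)" for e
  have mn: "(mat_norm H u)\<^sup>2 = (\<Sum>e\<in>UNIV. w $ e * (h $ e)\<^sup>2)"
    unfolding H_def h_def using w0 by (intro mat_norm_weighted_gram(1)) (simp add: less_imp_le)
  have N0: "0 \<le> mat_norm H u"
    unfolding H_def using w0 by (subst mat_norm_weighted_gram_eq_norm) (auto simp: less_imp_le)
  have mnN: "(mat_norm H u)\<^sup>2 \<le> N\<^sup>2" by (rule power_mono[OF N N0])
  define k where "k = (1 - t) * (1 / \<gamma> - 1 / \<Gamma>)"
  have k: "0 \<le> k" using t \<gamma> by (simp add: k_def frac_le)
  have "norm ((A *v r) v* A) \<le> (sqrt \<mu>n)\<^sup>2 * norm a + sqrt \<mu>n * sqrt 2 * (\<Sum>e\<in>UNIV. b e)"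
  proof (rule norm_gram_split_le[OF ub _ col])
    show "\<bar>r $ e\<bar> \<le> a $ e + b e" for e using r[of e] by (simp add: a_def b_def h_def)
    show "0 \<le> a $ e" for e using k by (simp add: a_def k_def[symmetric])
    show "0 \<le> b e" for e unfolding b_def using \<delta> \<gamma> w0[of e]
      by (intro mult_nonneg_nonneg add_nonneg_nonneg) auto
  qed (use \<mu>n in simp)
  also have "norm a \<le> k * (sqrt \<Gamma> * N)"
  proof -
    have "norm a \<le> norm (k *\<^sub>R h)"
      by (rule norm_le_componentwise_cart) (use k in \<open>simp add: a_def k_def[symmetric] abs_mult\<close>)
    also have "\<dots> = k * norm h" using k by simp
    also have "norm h \<le> sqrt \<Gamma> * N"
    proof (rule power2_le_imp_le)
      have "1 / \<Gamma> * (norm h)\<^sup>2 \<le> (mat_norm H u)\<^sup>2"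
        unfolding mn norm_vec_sq sum_distrib_left by (intro sum_mono mult_right_mono w) auto
      then have "1 / \<Gamma> * (norm h)\<^sup>2 \<le> N\<^sup>2" using mnN by (rule order_trans)
      then show "(norm h)\<^sup>2 \<le> (sqrt \<Gamma> * N)\<^sup>2" using \<Gamma> by (simp add: power_mult_distrib field_simps)
      show "0 \<le> sqrt \<Gamma> * N" using \<Gamma> N N0 by (meson less_imp_le mult_nonneg_nonneg order_trans real_sqrt_ge_zero)
    qed
    finally show ?thesis using k by (simp add: mult_left_mono)
  qed
  also have "(\<Sum>e\<in>UNIV. b e) \<le> t\<^sup>2 * (\<delta> / 6 * (\<Gamma> / \<gamma> + 2) * N\<^sup>2)"
  proof -
    have "b e \<le> t\<^sup>2 * (\<delta> / 6 * ((\<Gamma> / \<gamma> + 2) * (w $ e * (h $ e)\<^sup>2)))" for e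
    proof -
      have "1 / \<gamma> * 1 \<le> 1 / \<gamma> * (\<Gamma> * w $ e)" using w[of e] \<gamma> \<Gamma>
        by (intro mult_left_mono) (auto simp: field_simps)
      then have "1 / \<gamma> + 2 * w $ e \<le> (\<Gamma> / \<gamma> + 2) * w $ e" by (simp add: algebra_simps)
      then have "(1 / \<gamma> + 2 * w $ e) * (h $ e)\<^sup>2 \<le> (\<Gamma> / \<gamma> + 2) * w $ e * (h $ e)\<^sup>2"
        by (rule mult_right_mono) simp
      then have "t\<^sup>2 * (\<delta> / 6 * ((1 / \<gamma> + 2 * w $ e) * (h $ e)\<^sup>2))
          \<le> t\<^sup>2 * (\<delta> / 6 * ((\<Gamma> / \<gamma> + 2) * w $ e * (h $ e)\<^sup>2))"
        using \<delta> by (intro mult_left_mono) auto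
      then show ?thesis by (simp add: b_def mult.assoc)
    qed
    then have "(\<Sum>e\<in>UNIV. b e) \<le> (\<Sum>e\<in>UNIV. t\<^sup>2 * (\<delta> / 6 * ((\<Gamma> / \<gamma> + 2) * (w $ e * (h $ e)\<^sup>2))))"
      by (rule sum_mono)
    also have "\<dots> = t\<^sup>2 * (\<delta> / 6 * ((\<Gamma> / \<gamma> + 2) * (mat_norm H u)\<^sup>2))"
      unfolding mn sum_distrib_left ..
    also have "\<dots> \<le> t\<^sup>2 * (\<delta> / 6 * ((\<Gamma> / \<gamma> + 2) * N\<^sup>2))"
      using \<delta> \<gamma> \<Gamma> by (intro mult_left_mono mnN) auto
    finally show ?thesis by (simp add: mult.assoc)
  qed
  finally show ?thesis using \<mu>n by (simp add: k_def mult_left_mono mult_ac)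
qed

section \<open>Scalar inequalities behind the contraction\<close>

text \<open>At \<open>G = \<xi> (1 - \<xi>) / \<zeta>\<close> the bound on \<open>G'\<close> is at most \<open>\<xi> G\<close>, and the two right-hand sides agree there.
Below this point \<open>P + S \<zeta> G\<close> is smaller, and above it \<open>(P + S \<zeta> G) / G\<close> is smaller. For
\<open>S = 1\<close> the condition is \<open>P \<le> \<xi>\<^sup>2\<close>; the general form allows a trade between the linear and
the quadratic coefficient, also with \<open>S > 1\<close>.\<close>

lemma convergence_phases:
  fixes \<xi> \<zeta> G G' P S :: real
  assumes \<zeta>: "0 < \<zeta>" and \<xi>: "0 < \<xi>" "\<xi> < 1" and G: "0 \<le> G" and S: "0 \<le> S" and P: "0 \<le> P"
    and PS: "P \<le> \<xi>\<^sup>2 + (1 - S) * (\<xi> * (1 - \<xi>))" and step: "G' \<le> P * G + S * \<zeta> * G\<^sup>2"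
  shows "\<xi> * (1 - \<xi>) / \<zeta> \<le> G \<Longrightarrow> G' \<le> 1 / ((1 - \<xi>) / \<zeta>) * G\<^sup>2"
    and "G \<le> \<xi> * (1 - \<xi>) / \<zeta> \<Longrightarrow> G' \<le> \<xi> * G"
proof -
  define T where "T = \<xi> * (1 - \<xi>)"
  have T: "0 < T" using \<xi> by (simp add: T_def)
  show "G' \<le> 1 / ((1 - \<xi>) / \<zeta>) * G\<^sup>2" if "\<xi> * (1 - \<xi>) / \<zeta> \<le> G"
  proof -
    have "T \<le> \<zeta> * G" using that \<zeta> by (simp add: T_def field_simps)
    then have "P * G * T \<le> P * G * (\<zeta> * G)" using P G by (intro mult_left_mono) auto
    moreover have "P * (\<zeta> * G\<^sup>2) \<le> (\<xi>\<^sup>2 + (1 - S) * T) * (\<zeta> * G\<^sup>2)"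
      using PS \<zeta> by (intro mult_right_mono) (auto simp: T_def)
    moreover have "G' * T \<le> (P * G + S * \<zeta> * G\<^sup>2) * T" using step T by (intro mult_right_mono) auto
    ultimately have "G' * T \<le> (\<xi>\<^sup>2 + T) * (\<zeta> * G\<^sup>2)" by (simp add: algebra_simps power2_eq_square)
    moreover have "\<xi>\<^sup>2 + T = \<xi>" by (simp add: T_def power2_eq_square algebra_simps)
    ultimately have "\<xi> * (G' * (1 - \<xi>)) \<le> \<xi> * (\<zeta> * G\<^sup>2)" by (simp add: T_def algebra_simps)
    then have "G' * (1 - \<xi>) \<le> \<zeta> * G\<^sup>2" using \<xi> by (simp add: mult_le_cancel_left)
    then show ?thesis using \<xi> by (simp add: field_simps)
  qed
  show "G' \<le> \<xi> * G" if "G \<le> \<xi> * (1 - \<xi>) / \<zeta>"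
  proof -
    have "\<zeta> * G \<le> T" using that \<zeta> by (simp add: T_def field_simps)
    then have "S * G * (\<zeta> * G) \<le> S * G * T" using S G by (intro mult_left_mono) auto
    moreover have "P * G \<le> (\<xi>\<^sup>2 + (1 - S) * T) * G" using PS G by (intro mult_right_mono) (auto simp: T_def)
    ultimately have "G' \<le> (\<xi>\<^sup>2 + T) * G" using step by (simp add: algebra_simps power2_eq_square)
    then show ?thesis by (simp add: T_def power2_eq_square algebra_simps)
  qed
qed

lemma sqrt2_bound: "sqrt 2 < (14143 / 10000 :: real)"
  by (rule real_less_lsqrt) (auto simp: power2_eq_square)

text \<open>The condition for \<open>t = 4/5\<close> in the limit of \<open>\<epsilon>\<close> to 0, with \<open>\<xi>\<close> replaced by its value for \<open>m = 1\<close>,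
which is a lower bound. In terms of \<open>v = \<surd>m\<close> one has
\<open>C = V / v\<close> with \<open>V\<close> depending on \<open>\<kappa>\<close> only, and \<open>C > 1\<close> means \<open>v < V\<close>. The difference of the two sides
is concave in \<open>v\<close>, so the endpoints \<open>v = 1\<close> and \<open>v = V\<close> suffice. There, the substitution
\<open>y = \<kappa> + \<surd>(\<kappa>\<^sup>2 - 1)\<close> rationalizes everything.\<close>

lemma saturation_inequality:
  fixes m \<kappa> :: real
  assumes m: "1 \<le> m" and \<kappa>: "1 \<le> \<kappa>" and C: "C = sqrt (2 / m) * ((\<kappa> + 2) / (3 * \<kappa>))" and C1: "1 < C"
    and \<xi>: "\<xi> = sqrt (1 - 1 / \<kappa>\<^sup>2)"
  shows "m * (\<kappa> - 1) \<le> (5 - 16 / 5 * C) * (\<xi> / (1 + \<xi>))" and "\<kappa> < 9 / 5"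
proof -
  define \<beta> where "\<beta> = (\<kappa> + 2) / (3 * \<kappa>)"
  define v where "v = sqrt m"
  define V where "V = sqrt 2 * \<beta>"
  have \<beta>: "0 < \<beta>" using \<kappa> by (simp add: \<beta>_def)
  have v: "1 \<le> v" "v\<^sup>2 = m" using m by (auto simp: v_def)
  have CV: "C = V / v" using m by (simp add: C V_def v_def \<beta>_def real_sqrt_divide)
  have vV: "v < V" using C1 v by (simp add: CV field_simps)
  have V: "V \<le> 14143 / 10000 * \<beta>" using sqrt2_bound \<beta> by (simp add: V_def)
  have "1 < 14143 / 10000 * \<beta>" using v vV V by linarith
  then have \<kappa>2: "\<kappa> < 1784 / 1000" using \<kappa> by (simp add: \<beta>_def field_simps)
  then show "\<kappa> < 9 / 5" by simp
  define r where "r = sqrt (\<kappa>\<^sup>2 - 1)"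
  have "0 \<le> \<kappa>\<^sup>2 - 1" using \<kappa> by simp
  then have r: "0 \<le> r" "r\<^sup>2 = \<kappa>\<^sup>2 - 1" by (auto simp: r_def)
  define y where "y = \<kappa> + r"
  have y1: "1 \<le> y" using \<kappa> r by (simp add: y_def)
  have ky: "2 * \<kappa> * y = y\<^sup>2 + 1" using r(2) by (simp add: y_def power2_eq_square algebra_simps)
  have y3: "y \<le> 33 / 10"
  proof (rule ccontr)
    assume "\<not> y \<le> 33 / 10"
    then have "0 \<le> (y - 33 / 10) * (y - 10 / 33)" by simp
    have "2 * \<kappa> * y \<le> 2 * (1784 / 1000) * y" using \<kappa>2 y1 by (intro mult_right_mono) auto
    then have le: "y\<^sup>2 + 1 \<le> 3568 / 1000 * y" unfolding ky by simp
    have "1189 * y \<le> 330 * (y\<^sup>2 + 1)"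
      using \<open>0 \<le> (y - 33 / 10) * (y - 10 / 33)\<close> by (simp add: power2_eq_square algebra_simps)
    also have "\<dots> \<le> 330 * (3568 / 1000 * y)" by (rule mult_left_mono[OF le]) simp
    finally show False using y1 by simp
  qed
  have \<kappa>y: "\<kappa> = (y\<^sup>2 + 1) / (2 * y)" using ky y1 by (simp add: field_simps)
  have k1: "\<kappa> - 1 = (y - 1)\<^sup>2 / (2 * y)" using y1 by (simp add: \<kappa>y field_simps power2_eq_square)
  have "\<xi> = r / \<kappa>" 
  proof -
    have "1 - 1 / \<kappa>\<^sup>2 = (\<kappa>\<^sup>2 - 1) / \<kappa>\<^sup>2" using \<kappa> by (simp add: diff_divide_distrib)
    then show ?thesis using \<kappa> by (simp add: \<xi> r_def real_sqrt_divide)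
  qed
  moreover have "1 + r / \<kappa> = y / \<kappa>" using \<kappa> by (simp add: y_def field_simps)
  ultimately have "\<xi> / (1 + \<xi>) = r / y" using \<kappa> by simp
  also have "r = (y\<^sup>2 - 1) / (2 * y)"
    using ky y1 by (simp add: field_simps) (simp add: y_def algebra_simps power2_eq_square)
  finally have q: "\<xi> / (1 + \<xi>) = (y\<^sup>2 - 1) / (2 * y\<^sup>2)" using y1 by (simp add: power2_eq_square)
  define q where "q = \<xi> / (1 + \<xi>)"
  have q0: "0 \<le> q" using y1 by (simp add: q_def q)
  have \<beta>y: "\<beta> = (y\<^sup>2 + 1 + 4 * y) / (3 * (y\<^sup>2 + 1))"
    unfolding \<beta>_def \<kappa>y using y1 by (simp add: field_simps add_nonneg_eq_0_iff)
  \<comment> \<open>The claim at \<open>\<surd>m = 1\<close>.\<close>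
  have a: "\<kappa> - 1 \<le> (5 - 16 / 5 * V) * q"
  proof -
    \<comment> \<open>The difference of the two sides of this quartic inequality is a nonnegative product containing
      \<open>y - 1\<close> and \<open>33/10 - y\<close> plus positive terms.\<close>
    have "0 \<le> (y - 1) * (33 / 10 - y) * (y * (3 * y - 574 / 1000))"
      using y1 y3 by (intro mult_nonneg_nonneg) auto
    moreover have "0 \<le> 24 / 100000 * y ^ 3" using y1 by simp
    moreover have "0 \<le> 17394 / 10000 * (y - 15 / 8)\<^sup>2" by simp
    moreover have "0 \<le> 4359161875 / 1000000000 - 25 / 100000 * y" using y3 by simp
    moreover have "(y + 1) * (15 * (y\<^sup>2 + 1) - 16 / 5 * (14143 / 10000) * (y\<^sup>2 + 1 + 4 * y))
          - 3 * y * (y - 1) * (y\<^sup>2 + 1)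
        = (y - 1) * (33 / 10 - y) * (y * (3 * y - 574 / 1000)) + 24 / 100000 * y ^ 3
          + 17394 / 10000 * (y - 15 / 8)\<^sup>2 + (4359161875 / 1000000000 - 25 / 100000 * y)"
      by algebra
    ultimately have "3 * y * (y - 1) * (y\<^sup>2 + 1)
        \<le> (y + 1) * (15 * (y\<^sup>2 + 1) - 16 / 5 * (14143 / 10000) * (y\<^sup>2 + 1 + 4 * y))"
      by linarith
    also have "\<dots> = 3 * (y\<^sup>2 + 1) * ((y + 1) * (5 - 16 / 5 * (14143 / 10000 * \<beta>)))"
    proof -
      have "3 * (y\<^sup>2 + 1) * \<beta> = y\<^sup>2 + 1 + 4 * y"
        unfolding \<beta>y using y1 by (simp add: field_simps add_nonneg_eq_0_iff)
      then have "3 * (y\<^sup>2 + 1) * \<beta> * (y + 1) = (y\<^sup>2 + 1 + 4 * y) * (y + 1)" by simp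
      then show ?thesis by algebra
    qed
    finally have "3 * (y\<^sup>2 + 1) * (y * (y - 1)) \<le> 3 * (y\<^sup>2 + 1) * ((y + 1) * (5 - 16 / 5 * (14143 / 10000 * \<beta>)))"
      by (simp add: algebra_simps)
    then have "y * (y - 1) \<le> (y + 1) * (5 - 16 / 5 * (14143 / 10000 * \<beta>))"
      by (rule mult_left_le_imp_le) (simp add: add_nonneg_pos)
    then have "y * (y - 1) * ((y - 1) / (2 * y\<^sup>2)) \<le> (y + 1) * (5 - 16 / 5 * (14143 / 10000 * \<beta>)) * ((y - 1) / (2 * y\<^sup>2))"
      using y1 by (intro mult_right_mono) auto
    moreover have "y * (y - 1) * ((y - 1) / (2 * y\<^sup>2)) = \<kappa> - 1"
      unfolding k1 using y1 by (simp add: field_simps power2_eq_square)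
    moreover have "(y + 1) * (5 - 16 / 5 * (14143 / 10000 * \<beta>)) * ((y - 1) / (2 * y\<^sup>2)) = (5 - 16 / 5 * (14143 / 10000 * \<beta>)) * q"
      unfolding q_def q using y1 by (simp add: field_simps power2_eq_square)
    moreover have "(5 - 16 / 5 * (14143 / 10000 * \<beta>)) * q \<le> (5 - 16 / 5 * V) * q"
      using V q0 by (intro mult_right_mono) auto
    ultimately show ?thesis by linarith
  qed
  \<comment> \<open>The claim at \<open>\<surd>m = V\<close>.\<close>
  have b: "V\<^sup>2 * (\<kappa> - 1) \<le> 9 / 5 * q"
  proof -
    \<comment> \<open>As a function of \<open>\<kappa>\<close>, \<open>\<beta>\<^sup>2\<close> is convex and lies below a chord over \<open>[1, 9/5]\<close>.\<close>
    have "0 \<le> (\<kappa> - 1) * (9 / 5 - \<kappa>) * (567 / 100 * \<kappa> + 22 / 10)"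
      and "0 \<le> (\<kappa> - 1) * (1 / 25 - 3 / 500 * \<kappa>)"
      using \<kappa> \<kappa>2 by (intro mult_nonneg_nonneg; simp)+
    moreover have "9 * \<kappa>\<^sup>2 * (163 / 100 - 63 / 100 * \<kappa>) - (\<kappa> + 2)\<^sup>2
        = (\<kappa> - 1) * (9 / 5 - \<kappa>) * (567 / 100 * \<kappa> + 22 / 10) + (\<kappa> - 1) * (1 / 25 - 3 / 500 * \<kappa>)"
      by algebra
    ultimately have "(\<kappa> + 2)\<^sup>2 \<le> 9 * \<kappa>\<^sup>2 * (163 / 100 - 63 / 100 * \<kappa>)" by linarith
    then have \<beta>2: "\<beta>\<^sup>2 \<le> 1 - 63 / 100 * (\<kappa> - 1)"
      using \<kappa> by (simp add: \<beta>_def power_divide power_mult_distrib field_simps)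
    \<comment> \<open>The resulting cubic inequality is tightest near \<open>y = 19/6\<close>.\<close>
    have "0 \<le> 315 / 1000 * ((y - 19 / 6)\<^sup>2 * (y + 4 / 25))" using y1 by simp
    moreover have "0 \<le> 199 / 2500 + y * (109 / 20000 - y / 2500)" using y1 y3 by simp
    moreover have "9 / 10 * (y + 1) - (y - 1) * (y - 315 / 1000 * (y - 1)\<^sup>2)
        = 315 / 1000 * ((y - 19 / 6)\<^sup>2 * (y + 4 / 25))
          + (199 / 2500 + y * (109 / 20000 - y / 2500))"
      by (simp add: field_simps power2_eq_square)
    ultimately have "(y - 1) * (y - 315 / 1000 * (y - 1)\<^sup>2) \<le> 9 / 10 * (y + 1)" by linarith
    then have "(y - 1) * (y - 315 / 1000 * (y - 1)\<^sup>2) * ((y - 1) / y\<^sup>2) \<le> 9 / 10 * (y + 1) * ((y - 1) / y\<^sup>2)"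
      using y1 by (intro mult_right_mono) auto
    moreover have "9 / 10 * (y + 1) * ((y - 1) / y\<^sup>2) = 9 / 5 * q"
      unfolding q_def q using y1 by (simp add: field_simps power2_eq_square)
    moreover have "(y - 1) * (y - 315 / 1000 * (y - 1)\<^sup>2) * ((y - 1) / y\<^sup>2)
        = 2 * (1 - 63 / 100 * (\<kappa> - 1)) * (\<kappa> - 1)"
      unfolding k1 using y1 by (simp add: field_simps power2_eq_square)
    moreover have "2 * \<beta>\<^sup>2 * (\<kappa> - 1) \<le> 2 * (1 - 63 / 100 * (\<kappa> - 1)) * (\<kappa> - 1)"
      using \<kappa> by (intro mult_right_mono mult_left_mono \<beta>2) auto
    ultimately have "2 * \<beta>\<^sup>2 * (\<kappa> - 1) \<le> 9 / 5 * q" by (metis order_trans)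
    then show ?thesis by (simp add: V_def power_mult_distrib)
  qed
  \<comment> \<open>In between, both \<open>m = v\<^sup>2\<close> and \<open>C = V / v\<close> lie below their secants over \<open>[1, V]\<close>.\<close>
  have "(v - 1) * (V - v) \<ge> 0" using v vV by simp
  then have s: "m \<le> (1 + V) * v - V" "C \<le> V + 1 - v"
    using v by (simp_all add: CV v(2)[symmetric] field_simps power2_eq_square)
  have "m * (\<kappa> - 1) \<le> ((1 + V) * v - V) * (\<kappa> - 1)" using s(1) \<kappa> by (intro mult_right_mono) auto
  moreover have "(5 - 16 / 5 * (V + 1 - v)) * q \<le> (5 - 16 / 5 * C) * q"
    using s(2) q0 by (intro mult_right_mono) auto
  moreover have "((1 + V) * v - V) * (\<kappa> - 1) \<le> (5 - 16 / 5 * (V + 1 - v)) * q"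
  proof -
    have V1: "0 < V - 1" using v vV by simp
    have "(V - v) * (\<kappa> - 1) \<le> (V - v) * ((5 - 16 / 5 * V) * q)"
      and "(v - 1) * (V\<^sup>2 * (\<kappa> - 1)) \<le> (v - 1) * (9 / 5 * q)"
      using a b v vV by (intro mult_left_mono; simp)+
    moreover have "(V - 1) * (((1 + V) * v - V) * (\<kappa> - 1))
        = (V - v) * (\<kappa> - 1) + (v - 1) * (V\<^sup>2 * (\<kappa> - 1))"
      by algebra
    moreover have "(V - 1) * ((5 - 16 / 5 * (V + 1 - v)) * q)
        = (V - v) * ((5 - 16 / 5 * V) * q) + (v - 1) * (9 / 5 * q)"
      by algebra
    ultimately have "(V - 1) * (((1 + V) * v - V) * (\<kappa> - 1)) \<le> (V - 1) * ((5 - 16 / 5 * (V + 1 - v)) * q)"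
      by (metis add_mono)
    then show ?thesis using V1 by (simp add: mult_le_cancel_left)
  qed
  ultimately show "m * (\<kappa> - 1) \<le> (5 - 16 / 5 * C) * (\<xi> / (1 + \<xi>))" unfolding q_def by linarith
qed

text \<open>The trade-off between the two estimates of the linear part and the parameter \<open>t\<close> of the remainder, in
the form required by \<open>convergence_phases\<close>.

\<^item> If \<open>C \<le> 1\<close>, then \<open>t = 1\<close> and the first estimate \<open>\<xi>\<^sup>2\<close> suffice.
\<^item> If \<open>C > 1\<close> and \<open>\<epsilon> \<ge> (\<surd>2 - 1) / 2\<close>, then \<open>t = 1\<close> and the second estimate suffice. The excess
  \<open>C - 1\<close> is at most \<open>\<surd>2 - 1\<close>, and the inequality to be proved is affine in \<open>M\<close>, so it need only
  be checked at \<open>M = 1\<close> and \<open>M = 1/\<epsilon>\<close>. The case \<open>M = 1\<close> gives the threshold for \<open>\<epsilon>\<close>.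
\<^item> Otherwise \<open>t = 4/5\<close> and the second estimate suffice: the limit of \<open>\<epsilon>\<close> to 0 is
  \<open>saturation_inequality\<close>, and the terms of first order in \<open>\<epsilon>\<close> have the right sign.\<close>

lemma contraction_bound:
  fixes m \<kappa> \<epsilon> \<alpha> \<xi> C :: real
  assumes m: "1 \<le> m" and \<kappa>: "1 \<le> \<kappa>" and \<epsilon>: "0 < \<epsilon>" and M: "M = m * sqrt \<kappa>" and \<epsilon>M: "\<epsilon> * M < 1"
    and \<alpha>: "\<alpha> = exp (- (\<epsilon>\<^sup>2)) / (1 + \<epsilon>)\<^sup>2 / (m * \<kappa>)\<^sup>2"
    and \<xi>: "\<xi> = sqrt (1 - \<alpha> + \<alpha> * \<epsilon> * M)" and C: "C = sqrt (2 / m) * ((\<kappa> + 2) / (3 * \<kappa>))"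
  shows "0 < \<alpha>" and "\<alpha> \<le> 1" and "\<alpha> * (1 + \<epsilon> ^ 4 / 2) \<le> 1" and "\<alpha> * (1 + \<epsilon>)\<^sup>2 * \<kappa> \<le> exp (- (\<epsilon>\<^sup>2))"
    and "0 < \<xi>" and "\<xi> < 1"
    and "\<exists>t P. 0 \<le> t \<and> t \<le> 1 \<and> 0 \<le> P \<and> P \<le> \<xi>\<^sup>2 + (1 - t\<^sup>2 * C) * (\<xi> * (1 - \<xi>)) \<and>
      min (1 - \<alpha> + \<alpha> * \<epsilon> * M) (1 - \<alpha> * (1 + \<epsilon> ^ 4 / 2) + \<alpha> * M * (\<epsilon>\<^sup>2 + \<epsilon> ^ 4 / 2))
        + (1 - t) * (\<alpha> * (1 + \<epsilon>) * (m * (\<kappa> - 1))) \<le> P"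
proof -
  define \<theta> where "\<theta> = 1 - \<epsilon> * M"
  define c where "c = 1 + \<epsilon> ^ 4 / 2"
  define \<sigma> where "\<sigma> = \<epsilon>\<^sup>2 + \<epsilon> ^ 4 / 2"
  have "1 \<le> sqrt \<kappa>" using \<kappa> by simp
  then have "1 * 1 \<le> m * sqrt \<kappa>" "m * 1 \<le> m * sqrt \<kappa>" using m by (intro mult_mono; simp)+
  then have M1: "1 \<le> M" "m \<le> M" by (auto simp: M)
  have "\<epsilon> * 1 \<le> \<epsilon> * M" using M1 \<epsilon> by (intro mult_left_mono) auto
  then have \<epsilon>1: "\<epsilon> < 1" using \<epsilon>M by simp
  have \<theta>: "0 < \<theta>" "\<theta> < 1" using \<epsilon>M M1 \<epsilon> by (auto simp: \<theta>_def)
  have mk: "1 \<le> \<kappa>\<^sup>2" "\<kappa>\<^sup>2 \<le> (m * \<kappa>)\<^sup>2"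
    using \<kappa> m by (auto intro!: power_mono simp: mult_le_cancel_right1)
  show \<alpha>0: "0 < \<alpha>" unfolding \<alpha> using \<kappa> m \<epsilon> by simp
  have e: "exp (- (\<epsilon>\<^sup>2)) \<le> 1" by simp
  have p1: "1 \<le> (1 + \<epsilon>)\<^sup>2" using \<epsilon> by simp
  have \<alpha>e: "\<alpha> * (1 + \<epsilon>)\<^sup>2 \<le> 1 / \<kappa>\<^sup>2"
  proof -
    have "\<alpha> * (1 + \<epsilon>)\<^sup>2 = exp (- (\<epsilon>\<^sup>2)) / (m * \<kappa>)\<^sup>2" unfolding \<alpha> using \<epsilon> by simp
    also have "\<dots> \<le> 1 / \<kappa>\<^sup>2" using e mk by (intro frac_le) auto
    finally show ?thesis .
  qed
  have "\<alpha> * 1 \<le> \<alpha> * (1 + \<epsilon>)\<^sup>2" using \<alpha>0 p1 by (intro mult_left_mono) auto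
  then have \<alpha>k: "\<alpha> \<le> 1 / \<kappa>\<^sup>2" using \<alpha>e by simp
  have "1 / \<kappa>\<^sup>2 \<le> 1" using mk(1) \<kappa> by (intro iffD2[OF divide_le_eq_1_pos]) auto
  then show \<alpha>1: "\<alpha> \<le> 1" using \<alpha>k by linarith
  have \<alpha>\<theta>: "0 < \<alpha> * \<theta>" "\<alpha> * \<theta> < 1" 
  proof -
    show "0 < \<alpha> * \<theta>" using \<alpha>0 \<theta> by simp
    have "\<alpha> * \<theta> < \<alpha> * 1" using \<alpha>0 \<theta> by (intro mult_strict_left_mono) auto
    then show "\<alpha> * \<theta> < 1" using \<alpha>1 by simp
  qed
  have \<xi>': "\<xi> = sqrt (1 - \<alpha> * \<theta>)" by (simp add: \<xi> \<theta>_def algebra_simps)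
  have \<xi>2: "\<xi>\<^sup>2 = 1 - \<alpha> * \<theta>" using \<alpha>\<theta> by (simp add: \<xi>')
  show \<xi>0: "0 < \<xi>" using \<alpha>\<theta> by (simp add: \<xi>')
  show \<xi>1: "\<xi> < 1" using \<alpha>\<theta> by (simp add: \<xi>')
  have half: "\<xi> * (1 - \<xi>) \<le> \<alpha> * \<theta> / 2"
    using zero_le_power2[of "1 - \<xi>"] \<xi>2 by (simp add: power2_eq_square algebra_simps)
  have Csqrt: "C \<le> sqrt 2"
  proof -
    have "sqrt (2 / m) \<le> sqrt 2" using m by (simp add: field_simps)
    moreover have "(\<kappa> + 2) / (3 * \<kappa>) \<le> 1" using \<kappa> by simp
    ultimately have "C \<le> sqrt 2 * 1" unfolding C using \<kappa> m by (intro mult_mono) auto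
    then show ?thesis by simp
  qed
  have "\<epsilon> ^ 4 \<le> \<epsilon>" using power_decreasing[of 1 4 \<epsilon>] \<epsilon> \<epsilon>1 by simp
  moreover have "(1 + \<epsilon>)\<^sup>2 = 1 + 2 * \<epsilon> + \<epsilon>\<^sup>2" by (simp add: power2_sum)
  ultimately have "c \<le> (1 + \<epsilon>)\<^sup>2" using \<epsilon> zero_le_power2[of \<epsilon>] unfolding c_def by linarith
  then have "\<alpha> * c \<le> \<alpha> * (1 + \<epsilon>)\<^sup>2" using \<alpha>0 by simp
  then have \<alpha>c: "\<alpha> * c \<le> 1" using \<alpha>e \<open>1 / \<kappa>\<^sup>2 \<le> 1\<close> by linarith
  then show "\<alpha> * (1 + \<epsilon> ^ 4 / 2) \<le> 1" by (simp add: c_def)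
  have "0 \<le> \<alpha> * M * \<sigma>" using \<alpha>0 M1 by (simp add: \<sigma>_def)
  then have L2: "0 \<le> 1 - \<alpha> * c + \<alpha> * M * \<sigma>" using \<alpha>c by linarith
  show "\<alpha> * (1 + \<epsilon>)\<^sup>2 * \<kappa> \<le> exp (- (\<epsilon>\<^sup>2))"
  proof -
    have "\<kappa> * 1 \<le> \<kappa> * \<kappa>" using \<kappa> by (intro mult_left_mono) auto
    then have "\<kappa> \<le> (m * \<kappa>)\<^sup>2" using mk(2) by (simp add: power2_eq_square[of \<kappa>])
    then have "\<kappa> / (m * \<kappa>)\<^sup>2 \<le> 1" using \<kappa> m by (intro iffD2[OF divide_le_eq_1_pos]) auto
    then have "exp (- (\<epsilon>\<^sup>2)) * (\<kappa> / (m * \<kappa>)\<^sup>2) \<le> exp (- (\<epsilon>\<^sup>2)) * 1"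
      by (rule mult_left_mono) simp
    moreover have "\<alpha> * (1 + \<epsilon>)\<^sup>2 * \<kappa> = exp (- (\<epsilon>\<^sup>2)) * (\<kappa> / (m * \<kappa>)\<^sup>2)"
      unfolding \<alpha> using \<epsilon> by simp
    ultimately show ?thesis by simp
  qed
  let ?goal = "\<lambda>t P. 0 \<le> t \<and> t \<le> 1 \<and> 0 \<le> P \<and> P \<le> \<xi>\<^sup>2 + (1 - t\<^sup>2 * C) * (\<xi> * (1 - \<xi>)) \<and>
      min (1 - \<alpha> + \<alpha> * \<epsilon> * M) (1 - \<alpha> * c + \<alpha> * M * \<sigma>)
        + (1 - t) * (\<alpha> * (1 + \<epsilon>) * (m * (\<kappa> - 1))) \<le> P"
  have "\<exists>t P. ?goal t P"
  proof -
    consider "C \<le> 1" | "1 < C" "(sqrt 2 - 1) / 2 \<le> \<epsilon>" | "1 < C" "\<epsilon> < (sqrt 2 - 1) / 2" by linarith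
    then show ?thesis
    proof cases
      case 1
      have "0 \<le> (1 - C) * (\<xi> * (1 - \<xi>))" using 1 \<xi>0 \<xi>1 by simp
      then have P: "\<xi>\<^sup>2 \<le> \<xi>\<^sup>2 + (1 - 1\<^sup>2 * C) * (\<xi> * (1 - \<xi>))" by simp
      have e1: "1 - \<alpha> + \<alpha> * \<epsilon> * M = \<xi>\<^sup>2" by (simp add: \<xi>2 \<theta>_def algebra_simps)
      have "?goal 1 (\<xi>\<^sup>2)" unfolding e1 by (intro conjI P) auto
      then show ?thesis by blast
    next
      case 2
      define a where "a = (sqrt 2 - 1) / 2"
      define f where "f M = c - M * \<sigma> - (1 + a) * (1 - \<epsilon> * M)" for M
      have "f 1 = (1 - \<epsilon>) * (\<epsilon> - a)"
        by (simp add: f_def c_def \<sigma>_def power2_eq_square algebra_simps)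
      then have f1: "0 \<le> f 1" using 2 \<epsilon>1 by (simp add: a_def)
      have "1 / \<epsilon> * \<sigma> = \<epsilon> + \<epsilon> ^ 3 / 2" "1 - \<epsilon> * (1 / \<epsilon>) = 0"
        using \<epsilon> by (simp_all add: \<sigma>_def power2_eq_square power3_eq_cube power4_eq_xxxx distrib_left)
      then have "f (1 / \<epsilon>) = c - (\<epsilon> + \<epsilon> ^ 3 / 2)" unfolding f_def by simp
      also have "\<dots> = (1 - \<epsilon>) * (1 - \<epsilon> ^ 3 / 2)"
        by (simp add: c_def field_simps power3_eq_cube power4_eq_xxxx)
      finally have "f (1 / \<epsilon>) = (1 - \<epsilon>) * (1 - \<epsilon> ^ 3 / 2)" .
      moreover have "\<epsilon> ^ 3 \<le> 1" using \<epsilon> \<epsilon>1 by (simp add: power_le_one)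
      ultimately have f2: "0 \<le> f (1 / \<epsilon>)" using \<epsilon>1 by simp
      have "\<epsilon> * f (1 / \<epsilon>) = \<epsilon> * c - \<sigma>" using \<epsilon> by (simp add: f_def right_diff_distrib)
      moreover have "(1 - \<epsilon>) * f M = \<theta> * f 1 + (M - 1) * (\<epsilon> * c - \<sigma>)"
        by (simp add: f_def \<theta>_def algebra_simps)
      ultimately have "(1 - \<epsilon>) * f M = \<theta> * f 1 + (M - 1) * (\<epsilon> * f (1 / \<epsilon>))" by simp
      also have "\<dots> \<ge> 0" using f1 f2 \<theta> \<epsilon> M1 by simp
      finally have "0 \<le> f M" using \<epsilon>1 by (simp add: zero_le_mult_iff)
      then have "0 \<le> \<alpha> * f M" using \<alpha>0 by simp
      then have "1 - \<alpha> * c + \<alpha> * M * \<sigma> \<le> 1 - \<alpha> * \<theta> - a * (\<alpha> * \<theta>)"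
        by (simp add: f_def \<theta>_def algebra_simps)
      moreover have "(C - 1) * (\<xi> * (1 - \<xi>)) \<le> (sqrt 2 - 1) * (\<alpha> * \<theta> / 2)"
        using Csqrt half \<xi>0 \<xi>1 2 by (intro mult_mono) auto
      moreover have "(sqrt 2 - 1) * (\<alpha> * \<theta> / 2) = a * (\<alpha> * \<theta>)" by (simp add: a_def)
      moreover have "(1 - 1\<^sup>2 * C) * (\<xi> * (1 - \<xi>)) = - ((C - 1) * (\<xi> * (1 - \<xi>)))"
        by (simp add: algebra_simps)
      ultimately have P: "1 - \<alpha> * c + \<alpha> * M * \<sigma> \<le> \<xi>\<^sup>2 + (1 - 1\<^sup>2 * C) * (\<xi> * (1 - \<xi>))"
        unfolding \<xi>2 by linarith
      have "?goal 1 (1 - \<alpha> * c + \<alpha> * M * \<sigma>)" by (intro conjI P L2) auto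
      then show ?thesis by blast
    next
      case 3
      define q where "q = \<xi> / (1 + \<xi>)"
      define \<xi>' where "\<xi>' = sqrt (1 - 1 / \<kappa>\<^sup>2)"
      define S where "S = 16 / 25 * C"
      have S: "16 / 25 \<le> S" "S \<le> 1" using 3(1) Csqrt sqrt2_bound by (auto simp: S_def)
      note sat = saturation_inequality[OF m \<kappa> C 3(1) \<xi>'_def]
      have "\<alpha> * \<theta> \<le> \<alpha> * 1" using \<alpha>0 \<theta> by (intro mult_left_mono) auto
      then have "\<alpha> * \<theta> \<le> 1 / \<kappa>\<^sup>2" using \<alpha>k by simp
      then have x: "0 \<le> \<xi>'" "\<xi>' \<le> \<xi>" using \<open>1 / \<kappa>\<^sup>2 \<le> 1\<close> by (auto simp: \<xi>'_def \<xi>')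
      have "z / (1 + z) = 1 - 1 / (1 + z)" if "0 \<le> z" for z :: real using that by (simp add: field_simps)
      moreover have "1 / (1 + \<xi>) \<le> 1 / (1 + \<xi>')" using x by (intro frac_le) auto
      ultimately have qq: "\<xi>' / (1 + \<xi>') \<le> q" using x \<xi>0 by (simp add: q_def)
      have qhalf: "q \<le> 1 / 2" "0 \<le> q" using \<xi>0 \<xi>1 by (auto simp: q_def field_simps)
      have "(5 - 16 / 5 * C) * (\<xi>' / (1 + \<xi>')) \<le> (5 - 16 / 5 * C) * q"
        using S qq by (intro mult_left_mono) (auto simp: S_def)
      moreover have "(5 - 16 / 5 * C) * q = 5 * ((1 - S) * q)" by (simp add: S_def algebra_simps)
      ultimately have main: "m * (\<kappa> - 1) / 5 \<le> (1 - S) * q" using sat(1) by linarith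
      have "m * (\<kappa> - 1) \<le> m * 1" using m sat(2) by (intro mult_left_mono) auto
      then have mM: "m * (\<kappa> - 1) \<le> M" using M1 by simp
      have "(1 - S) * q \<le> 9 / 25 * (1 / 2)" using S qhalf by (intro mult_mono) auto
      then have Sq: "(1 - S) * q \<le> 9 / 50" by simp
      have \<epsilon>2: "\<epsilon> \<le> 21 / 100" using 3(2) sqrt2_bound by simp
      have "\<epsilon>\<^sup>2 \<le> 21 / 100 * \<epsilon>" unfolding power2_eq_square using \<epsilon>2 \<epsilon> by (intro mult_right_mono) auto
      moreover have "\<epsilon> ^ 4 \<le> \<epsilon>\<^sup>2" using power_decreasing[of 2 4 \<epsilon>] \<epsilon> \<epsilon>1 by simp
      ultimately have \<sigma>e: "\<sigma> \<le> 31 / 50 * \<epsilon>" unfolding \<sigma>_def using \<epsilon> by linarith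
      have "\<epsilon> * (m * (\<kappa> - 1)) / 5 \<le> \<epsilon> * M / 5" using mM \<epsilon> by simp
      moreover have "M * \<sigma> \<le> M * (31 / 50 * \<epsilon>)" using \<sigma>e M1 by (intro mult_left_mono) auto
      moreover have "(1 - S) * q * (\<epsilon> * M) \<le> 9 / 50 * (\<epsilon> * M)" using Sq \<epsilon> M1 by (intro mult_right_mono) auto
      moreover have "1 \<le> c" by (simp add: c_def)
      moreover have "(1 + \<epsilon>) * (m * (\<kappa> - 1)) / 5 = m * (\<kappa> - 1) / 5 + \<epsilon> * (m * (\<kappa> - 1)) / 5"
        by (simp add: distrib_right add_divide_distrib)
      moreover have "(1 - S) * q * \<theta> = (1 - S) * q - (1 - S) * q * (\<epsilon> * M)"
        by (simp add: \<theta>_def right_diff_distrib)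
      moreover have "M * (31 / 50 * \<epsilon>) = 31 / 50 * (\<epsilon> * M)" by simp
      ultimately have key: "(1 + \<epsilon>) * (m * (\<kappa> - 1)) / 5 \<le> c - M * \<sigma> - \<theta> + (1 - S) * q * \<theta>"
        using main unfolding \<theta>_def by linarith
      have "\<xi> * (1 - \<xi>) = q * (1 - \<xi>\<^sup>2)"
        using \<xi>0 by (simp add: q_def field_simps power2_eq_square)
      then have xq: "\<xi> * (1 - \<xi>) = q * (\<alpha> * \<theta>)" by (simp add: \<xi>2)
      have "\<alpha> * ((1 + \<epsilon>) * (m * (\<kappa> - 1)) / 5) \<le> \<alpha> * (c - M * \<sigma> - \<theta> + (1 - S) * q * \<theta>)"
        using key \<alpha>0 by (intro mult_left_mono) auto
      then have P: "1 - \<alpha> * c + \<alpha> * M * \<sigma> + (1 - 4 / 5) * (\<alpha> * (1 + \<epsilon>) * (m * (\<kappa> - 1)))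
          \<le> \<xi>\<^sup>2 + (1 - (4 / 5)\<^sup>2 * C) * (\<xi> * (1 - \<xi>))"
        unfolding \<xi>2 xq by (simp add: S_def power2_eq_square algebra_simps add_divide_distrib diff_divide_distrib)
      have "0 \<le> \<alpha> * (1 + \<epsilon>) * (m * (\<kappa> - 1))" using \<alpha>0 \<epsilon> m \<kappa> by simp
      then have P0: "0 \<le> 1 - \<alpha> * c + \<alpha> * M * \<sigma> + (1 - 4 / 5) * (\<alpha> * (1 + \<epsilon>) * (m * (\<kappa> - 1)))"
        using L2 by simp
      have "?goal (4 / 5) (1 - \<alpha> * c + \<alpha> * M * \<sigma> + (1 - 4 / 5) * (\<alpha> * (1 + \<epsilon>) * (m * (\<kappa> - 1))))"
        by (intro conjI P P0) auto
      then show ?thesis by blast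
    qed
  qed
  then show "\<exists>t P. 0 \<le> t \<and> t \<le> 1 \<and> 0 \<le> P \<and> P \<le> \<xi>\<^sup>2 + (1 - t\<^sup>2 * C) * (\<xi> * (1 - \<xi>)) \<and>
      min (1 - \<alpha> + \<alpha> * \<epsilon> * M) (1 - \<alpha> * (1 + \<epsilon> ^ 4 / 2) + \<alpha> * M * (\<epsilon>\<^sup>2 + \<epsilon> ^ 4 / 2))
        + (1 - t) * (\<alpha> * (1 + \<epsilon>) * (m * (\<kappa> - 1))) \<le> P"
    unfolding c_def \<sigma>_def .
qed

section \<open>The three phases\<close>

theorem theorem3:
  fixes G :: "('n::finite, 'e::finite) pre_digraph"
    and \<Phi> :: "'e \<Rightarrow> real \<Rightarrow> real"
    and b :: "real ^ 'n"
    and \<gamma> \<Gamma> \<delta> \<omega> \<epsilon> \<mu>2 \<mu>n B \<alpha> \<xi> \<zeta> \<eta>0 \<eta>1 :: real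
    and lam d' g :: "nat \<Rightarrow> real ^ 'n"
  assumes "digraph G" and "verts G = UNIV" and "arcs G = UNIV"
    and "Digraph_Component.connected G"
    and "\<not> bipartite G"
    and "0 < \<omega>" and "\<omega> \<le> kth_eigenvalue (laplacian G) 2"
    and "(\<Sum>i\<in>UNIV. b $ i) = 0"
    and "0 < \<gamma>" and "\<gamma> \<le> \<Gamma>" and "0 < \<delta>"
    and "\<And>e. admissible_cost \<gamma> \<Gamma> \<delta> (\<Phi> e)"
    and "\<mu>2 = kth_eigenvalue (laplacian G) 2"
    and "\<mu>n = kth_eigenvalue (laplacian G) CARD('n)"
    and "B = \<mu>n * \<delta> / (\<gamma> * sqrt \<mu>2)"
    and "0 < \<epsilon>" and "\<epsilon> < \<mu>2 / \<mu>n * sqrt (\<gamma> / \<Gamma>)"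
    and "\<alpha> = exp (- (\<epsilon>\<^sup>2)) / (1 + \<epsilon>)\<^sup>2 * (\<gamma> / \<Gamma> * (\<mu>2 / \<mu>n))\<^sup>2"
    and "\<xi> = sqrt (1 - \<alpha> + \<alpha> * \<epsilon> * (\<mu>n / \<mu>2) * sqrt (\<Gamma> / \<gamma>))"
    and "\<zeta> = B * (\<alpha> * \<Gamma> * (1 + \<epsilon>))\<^sup>2 / (2 * \<mu>2\<^sup>2)"
    and "\<eta>0 = \<xi> * (1 - \<xi>) / \<zeta>"
    and "\<eta>1 = (1 - \<xi>) / \<zeta>"
    and "\<And>k. g k = dual_gradient G \<Phi> b (lam k)"
    and "\<And>k. approx_newton_direction \<epsilon> (dual_hessian G \<Phi> (lam k)) (g k) (d' k)"
    and "\<And>k. lam (Suc k) = lam k + \<alpha> *\<^sub>R d' k"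
  shows "(\<forall>k. \<eta>1 \<le> mat_norm (laplacian G) (g k) \<longrightarrow>
            dual G \<Phi> b (lam (Suc k)) - dual G \<Phi> b (lam k)
              \<le> - (1 / 2) * (exp (- 2 * \<epsilon>\<^sup>2) / (1 + \<epsilon>)\<^sup>2) * (\<gamma> ^ 3 / \<Gamma>\<^sup>2)
                  * (\<mu>2\<^sup>2 / \<mu>n ^ 4) * \<eta>1\<^sup>2) \<and>
         (\<forall>k. \<eta>0 \<le> mat_norm (laplacian G) (g k) \<and> mat_norm (laplacian G) (g k) \<le> \<eta>1 \<longrightarrow>
            mat_norm (laplacian G) (g (Suc k))
              \<le> 1 / \<eta>1 * (mat_norm (laplacian G) (g k))\<^sup>2) \<and>
         (\<forall>k. mat_norm (laplacian G) (g k) \<le> \<eta>0 \<longrightarrow>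
            mat_norm (laplacian G) (g (Suc k))
              \<le> sqrt (1 - \<alpha> + \<alpha> * \<epsilon> * (\<mu>n / \<mu>2) * sqrt (\<Gamma> / \<gamma>))
                  * mat_norm (laplacian G) (g k))"
proof -
  interpret digraph G by (rule assms(1))
  note \<gamma> = assms(9,10) and \<delta> = assms(11) and \<Phi> = assms(12) and \<epsilon>0 = assms(16)
  have loopfree: "tail G e \<noteq> head G e" for e using no_loops[of e] assms(3) by simp
  define A where "A = incidence_matrix G"
  have \<mu>2: "0 < \<mu>2" using assms(6,7,13) by simp
  note lap = laplacian_bounds[OF loopfree \<mu>2[unfolded assms(13)], folded assms(13,14) A_def]
  have \<mu>n: "0 < \<mu>n" using \<mu>2 lap(4) by linarith
  have \<Gamma>: "0 < \<Gamma>" using \<gamma> by simp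
  have L: "mat_norm (laplacian G) v = norm (v v* A)" for v
    by (simp add: laplacian_def A_def[symmetric] mat_norm_gram)
  define m where "m = \<mu>n / \<mu>2"
  define \<kappa> where "\<kappa> = \<Gamma> / \<gamma>"
  define M where "M = m * sqrt \<kappa>"
  define C where "C = sqrt (2 / m) * ((\<kappa> + 2) / (3 * \<kappa>))"
  have m: "1 \<le> m" using \<mu>2 lap(4) by (simp add: m_def)
  have \<kappa>: "1 \<le> \<kappa>" using \<gamma> by (simp add: \<kappa>_def)
  have Mpos: "0 < M" using m \<kappa> by (simp add: M_def)
  have "\<mu>2 / \<mu>n * sqrt (\<gamma> / \<Gamma>) = 1 / M"
    by (simp add: M_def m_def \<kappa>_def real_sqrt_divide)
  then have "\<epsilon> < 1 / M" using assms(17) by simp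
  then have \<epsilon>M: "\<epsilon> * M < 1" using Mpos by (simp add: pos_less_divide_eq)
  have "\<gamma> / \<Gamma> * (\<mu>2 / \<mu>n) = 1 / (m * \<kappa>)" by (simp add: m_def \<kappa>_def mult.commute)
  then have "(\<gamma> / \<Gamma> * (\<mu>2 / \<mu>n))\<^sup>2 = 1 / (m * \<kappa>)\<^sup>2" by (simp only: power_one_over)
  then have \<alpha>: "\<alpha> = exp (- (\<epsilon>\<^sup>2)) / (1 + \<epsilon>)\<^sup>2 / (m * \<kappa>)\<^sup>2"
    unfolding assms(18) by simp
  have \<xi>: "\<xi> = sqrt (1 - \<alpha> + \<alpha> * \<epsilon> * M)" unfolding assms(19) by (simp add: M_def m_def \<kappa>_def mult.assoc)
  note cb = contraction_bound[OF m \<kappa> \<epsilon>0 M_def \<epsilon>M \<alpha> \<xi> C_def]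
  have "1 \<le> M" using m \<kappa> mult_mono[of 1 m 1 "sqrt \<kappa>"] by (simp add: M_def)
  then have "\<epsilon> * 1 \<le> \<epsilon> * M" using \<epsilon>0 by (intro mult_left_mono) auto
  then have \<epsilon>1: "\<epsilon> < 1" using \<epsilon>M by simp
  have \<zeta>: "0 < \<zeta>" unfolding assms(20,15) using \<mu>2 \<mu>n \<gamma> \<Gamma> \<delta> \<epsilon>0 cb(1) by simp
  have \<eta>1: "0 \<le> \<eta>1" unfolding assms(22) using \<zeta> cb(6) by simp
  \<comment> \<open>The constant \<open>C\<close> is the ratio of the quadratic coefficient of the remainder to \<open>\<zeta>\<close>.\<close>
  have sqrt\<zeta>: "sqrt \<mu>n * sqrt 2 * (\<delta> / 6) * (\<Gamma> / \<gamma> + 2) * (\<alpha> * (1 + \<epsilon>) * (sqrt \<Gamma> / \<mu>2 * G0))\<^sup>2 = C * \<zeta> * G0\<^sup>2" for G0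
  proof -
    define p where "p = sqrt \<mu>n"
    define q where "q = sqrt \<mu>2"
    have p: "0 < p" "\<mu>n = p\<^sup>2" and q: "0 < q" "\<mu>2 = q\<^sup>2" using \<mu>n \<mu>2 by (auto simp: p_def q_def)
    have s\<Gamma>: "(sqrt \<Gamma>)\<^sup>2 = \<Gamma>" using \<Gamma> by simp
    have "sqrt (2 / m) = sqrt 2 * q / p" using \<mu>2 \<mu>n by (simp add: m_def p_def q_def real_sqrt_divide real_sqrt_mult)
    then have C: "C = sqrt 2 * q / p * ((\<Gamma> / \<gamma> + 2) / (3 * (\<Gamma> / \<gamma>)))" by (simp add: C_def \<kappa>_def)
    define X where "X = \<Gamma> / \<gamma> + 2"
    define Y where "Y = 1 + \<epsilon>"
    have z: "\<zeta> = p\<^sup>2 * \<delta> / (\<gamma> * q) * (\<alpha> * \<Gamma> * (1 + \<epsilon>))\<^sup>2 / (2 * (q\<^sup>2)\<^sup>2)"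
      unfolding assms(20,15) q_def[symmetric] unfolding p(2) q(2) ..
    show ?thesis
      unfolding C z p_def[symmetric] q(2) power_mult_distrib power_divide s\<Gamma>
      unfolding X_def[symmetric] Y_def[symmetric] using p q \<gamma> \<Gamma>
      by (simp add: field_simps power2_eq_square)
  qed
  have step: "(\<eta>1 \<le> norm (g k v* A) \<longrightarrow> dual G \<Phi> b (lam (Suc k)) - dual G \<Phi> b (lam k)
              \<le> - (1 / 2) * (exp (- 2 * \<epsilon>\<^sup>2) / (1 + \<epsilon>)\<^sup>2) * (\<gamma> ^ 3 / \<Gamma>\<^sup>2) * (\<mu>2\<^sup>2 / \<mu>n ^ 4) * \<eta>1\<^sup>2) \<and>
      (\<eta>0 \<le> norm (g k v* A) \<longrightarrow> norm (g (Suc k) v* A) \<le> 1 / \<eta>1 * (norm (g k v* A))\<^sup>2) \<and>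
      (norm (g k v* A) \<le> \<eta>0 \<longrightarrow> norm (g (Suc k) v* A) \<le> \<xi> * norm (g k v* A))" for k
  proof -
    define w :: "real ^ 'e" where "w = (\<chi> e. 1 / deriv (deriv (\<Phi> e)) (flow G \<Phi> (lam k) $ e))"
    define H where "H = A ** diag_matrix w ** transpose A"
    define G0 where "G0 = norm (g k v* A)"
    define u where "u = \<alpha> *\<^sub>R d' k"
    have H: "dual_hessian G \<Phi> (lam k) = H" by (simp add: dual_hessian_def H_def w_def A_def)
    have w: "1 / \<Gamma> \<le> w $ e" "w $ e \<le> 1 / \<gamma>" for e
    proof -
      have "\<gamma> \<le> deriv (deriv (\<Phi> e)) x" "deriv (deriv (\<Phi> e)) x \<le> \<Gamma>" for x
        using \<Phi>[of e] by (auto simp: admissible_cost_def)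
      then show "1 / \<Gamma> \<le> w $ e" "w $ e \<le> 1 / \<gamma>" unfolding w_def using \<gamma>
        by (auto intro!: frac_le intro: less_le_trans)
    qed
    have "0 < 1 / \<Gamma>" using \<Gamma> by simp
    then have w0: "0 \<le> w $ e" for e using w(1)[of e] by linarith
    have and': "approx_newton_direction \<epsilon> H (g k) (d' k)" using assms(24)[of k] by (simp add: H)
    obtain N where N: "0 \<le> N" "N \<le> sqrt \<Gamma> / \<mu>2 * G0" "\<gamma> / \<mu>n\<^sup>2 * G0\<^sup>2 \<le> N\<^sup>2"
      "mat_norm H (d' k) \<le> (1 + \<epsilon>) * N" "d' k \<bullet> g k \<le> - (exp (- (\<epsilon>\<^sup>2)) * N\<^sup>2)"
      and lin1: "norm ((g k + \<alpha> *\<^sub>R (H *v d' k)) v* A) \<le> (1 - \<alpha> + \<alpha> * \<epsilon> * M) * G0"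
      and lin2: "norm ((g k + \<alpha> *\<^sub>R (H *v d' k)) v* A)
        \<le> (1 - \<alpha> * (1 + \<epsilon> ^ 4 / 2) + \<alpha> * M * (\<epsilon>\<^sup>2 + \<epsilon> ^ 4 / 2)) * G0"
      using approx_newton_step[OF lap(1,2) \<mu>2 lap(3) \<mu>n \<gamma> w \<epsilon>0 \<epsilon>1 and'[unfolded H_def],
          folded H_def m_def \<kappa>_def, folded M_def] cb(1,2,3) unfolding G0_def
      by (metis less_imp_le)
    have "mat_norm H u = \<alpha> * mat_norm H (d' k)"
      unfolding H_def mat_norm_weighted_gram(2)[OF w0] u_def mat_norm_def
      using cb(1) by (simp add: matrix_vector_mult_scaleR real_sqrt_mult)
    also have "\<dots> \<le> \<alpha> * ((1 + \<epsilon>) * N)" using N(4) cb(1) by (intro mult_left_mono) auto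
    finally have Nu: "mat_norm H u \<le> \<alpha> * (1 + \<epsilon>) * N" by simp
    have mn0: "0 \<le> mat_norm H u" unfolding H_def by (subst mat_norm_weighted_gram_eq_norm[OF w0]) simp
    note ds = dual_step[where G = G and \<Phi> = \<Phi> and b = b and l = "lam k" and u = u, OF loopfree \<gamma> \<delta> \<Phi>, folded assms(23) A_def w_def, unfolded H]
    have lam: "lam (Suc k) = lam k + u" by (simp add: u_def assms(25))
    have phase1: "dual G \<Phi> b (lam (Suc k)) - dual G \<Phi> b (lam k)
        \<le> - (1 / 2) * (exp (- 2 * \<epsilon>\<^sup>2) / (1 + \<epsilon>)\<^sup>2) * (\<gamma> ^ 3 / \<Gamma>\<^sup>2) * (\<mu>2\<^sup>2 / \<mu>n ^ 4) * \<eta>1\<^sup>2"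
      if "\<eta>1 \<le> G0"
    proof -
      define E where "E = exp (- (\<epsilon>\<^sup>2))"
      have E: "0 < E" by (simp add: E_def)
      have "1 / \<Gamma> * (norm (u v* A))\<^sup>2 \<le> (mat_norm H u)\<^sup>2"
        unfolding H_def mat_norm_weighted_gram(1)[OF w0] norm_vec_sq sum_distrib_left
        by (intro sum_mono mult_right_mono w) auto
      also have "\<dots> \<le> (\<alpha> * (1 + \<epsilon>) * N)\<^sup>2" by (rule power_mono[OF Nu mn0])
      finally have "(norm (u v* A))\<^sup>2 \<le> \<Gamma> * (\<alpha> * (1 + \<epsilon>) * N)\<^sup>2" using \<Gamma> by (simp add: field_simps)
      then have "(norm (u v* A))\<^sup>2 / (2 * \<gamma>) \<le> \<Gamma> * (\<alpha> * (1 + \<epsilon>) * N)\<^sup>2 / (2 * \<gamma>)"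
        using \<gamma> by (intro divide_right_mono) auto
      also have "\<dots> = \<alpha> * N\<^sup>2 / 2 * (\<alpha> * (1 + \<epsilon>)\<^sup>2 * \<kappa>)"
        using \<gamma> by (simp add: \<kappa>_def field_simps power2_eq_square)
      \<comment> \<open>The step size makes the curvature term at most half of the slope term.\<close>
      also have "\<dots> \<le> \<alpha> * N\<^sup>2 / 2 * E" using cb(1,4) by (intro mult_left_mono) (auto simp: E_def)
      finally have quad: "(norm (u v* A))\<^sup>2 / (2 * \<gamma>) \<le> \<alpha> * N\<^sup>2 / 2 * E" .
      have "u \<bullet> g k \<le> \<alpha> * (- (E * N\<^sup>2))"
        unfolding u_def inner_scaleR_left E_def using N(5) cb(1) by (intro mult_left_mono) auto
      then have "dual G \<Phi> b (lam (Suc k)) - dual G \<Phi> b (lam k) \<le> - (\<alpha> * E / 2 * N\<^sup>2)"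
        using ds(1) quad unfolding lam by (simp add: algebra_simps)
      also have "\<dots> \<le> - (\<alpha> * E / 2 * (\<gamma> / \<mu>n\<^sup>2 * \<eta>1\<^sup>2))"
      proof -
        have "\<gamma> / \<mu>n\<^sup>2 * \<eta>1\<^sup>2 \<le> \<gamma> / \<mu>n\<^sup>2 * G0\<^sup>2"
          using that \<eta>1 \<gamma> by (intro mult_left_mono power_mono) auto
        then have "\<gamma> / \<mu>n\<^sup>2 * \<eta>1\<^sup>2 \<le> N\<^sup>2" using N(3) by linarith
        then show ?thesis using cb(1) E by (intro le_imp_neg_le mult_left_mono) auto
      qed
      also have "\<dots> = - (1 / 2) * (exp (- 2 * \<epsilon>\<^sup>2) / (1 + \<epsilon>)\<^sup>2) * (\<gamma> ^ 3 / \<Gamma>\<^sup>2) * (\<mu>2\<^sup>2 / \<mu>n ^ 4) * \<eta>1\<^sup>2"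
      proof -
        have "exp (- 2 * \<epsilon>\<^sup>2) = E * E" by (simp add: E_def exp_add[symmetric])
        then show ?thesis unfolding assms(18) E_def[symmetric]
          by (simp add: power_mult_distrib power_divide power2_eq_square power3_eq_cube power4_eq_xxxx mult_ac)
      qed
      finally show ?thesis .
    qed
    obtain t P where t: "0 \<le> t" "t \<le> 1" and P: "0 \<le> P"
      "P \<le> \<xi>\<^sup>2 + (1 - t\<^sup>2 * C) * (\<xi> * (1 - \<xi>))"
      "min (1 - \<alpha> + \<alpha> * \<epsilon> * M) (1 - \<alpha> * (1 + \<epsilon> ^ 4 / 2) + \<alpha> * M * (\<epsilon>\<^sup>2 + \<epsilon> ^ 4 / 2))
        + (1 - t) * (\<alpha> * (1 + \<epsilon>) * (m * (\<kappa> - 1))) \<le> P"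
      using cb(7) by blast
    obtain r where r: "g (Suc k) = g k + H *v u + A *v r"
      "\<And>e. \<bar>r $ e\<bar> \<le> (1 - t) * (1 / \<gamma> - 1 / \<Gamma>) * \<bar>(u v* A) $ e\<bar>
          + t\<^sup>2 * (\<delta> / 6 * (1 / \<gamma> + 2 * w $ e) * ((u v* A) $ e)\<^sup>2)"
      using ds(2) t unfolding assms(23)[of "Suc k"] lam by blast
    define N' where "N' = \<alpha> * (1 + \<epsilon>) * (sqrt \<Gamma> / \<mu>2 * G0)"
    have "\<alpha> * (1 + \<epsilon>) * N \<le> N'" unfolding N'_def using N(2) cb(1) \<epsilon>0 by (intro mult_left_mono) auto
    then have Nu': "mat_norm H u \<le> N'" using Nu by linarith
    have "norm ((A *v r) v* A) \<le> (1 - t) * (\<mu>n * (1 / \<gamma> - 1 / \<Gamma>) * sqrt \<Gamma>) * N'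
      + t\<^sup>2 * (sqrt \<mu>n * sqrt 2 * (\<delta> / 6) * (\<Gamma> / \<gamma> + 2)) * N'\<^sup>2"
      by (rule gradient_remainder_bound[OF lap(3) \<mu>n _ \<gamma> \<delta> w(1) t r(2) Nu'[unfolded H_def]])
        (simp add: A_def norm_incidence_column loopfree)
    also have "(1 - t) * (\<mu>n * (1 / \<gamma> - 1 / \<Gamma>) * sqrt \<Gamma>) * N'
        = (1 - t) * (\<alpha> * (1 + \<epsilon>) * (m * (\<kappa> - 1))) * G0"
    proof -
      have "(1 / \<gamma> - 1 / \<Gamma>) * (sqrt \<Gamma> * sqrt \<Gamma>) = \<kappa> - 1" using \<gamma> \<Gamma> by (simp add: \<kappa>_def field_simps)
      then have "\<mu>n * ((1 / \<gamma> - 1 / \<Gamma>) * (sqrt \<Gamma> * sqrt \<Gamma>)) / \<mu>2 = m * (\<kappa> - 1)" by (simp add: m_def)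
      from this[symmetric] show ?thesis unfolding N'_def
        by (simp only: times_divide_eq_right times_divide_eq_left mult_ac)
    qed
    also have "t\<^sup>2 * (sqrt \<mu>n * sqrt 2 * (\<delta> / 6) * (\<Gamma> / \<gamma> + 2)) * N'\<^sup>2 = t\<^sup>2 * C * \<zeta> * G0\<^sup>2"
      using sqrt\<zeta>[of G0] unfolding N'_def by (simp add: mult.assoc)
    finally have rem: "norm ((A *v r) v* A)
        \<le> (1 - t) * (\<alpha> * (1 + \<epsilon>) * (m * (\<kappa> - 1))) * G0 + t\<^sup>2 * C * \<zeta> * G0\<^sup>2" .
    \<comment> \<open>The better one of the two estimates of the linear part.\<close>
    define l where "l = min (1 - \<alpha> + \<alpha> * \<epsilon> * M) (1 - \<alpha> * (1 + \<epsilon> ^ 4 / 2) + \<alpha> * M * (\<epsilon>\<^sup>2 + \<epsilon> ^ 4 / 2))"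
    have "norm ((g k + \<alpha> *\<^sub>R (H *v d' k)) v* A) \<le> l * G0"
      unfolding l_def min_def using lin1 lin2 by simp
    moreover have "g (Suc k) v* A = (g k + \<alpha> *\<^sub>R (H *v d' k)) v* A + (A *v r) v* A"
      unfolding r(1) u_def by (simp add: vector_matrix_left_distrib matrix_vector_mult_scaleR)
    ultimately have "norm (g (Suc k) v* A)
        \<le> (l + (1 - t) * (\<alpha> * (1 + \<epsilon>) * (m * (\<kappa> - 1)))) * G0 + t\<^sup>2 * C * \<zeta> * G0\<^sup>2"
      using rem norm_triangle_ineq[of "(g k + \<alpha> *\<^sub>R (H *v d' k)) v* A" "(A *v r) v* A"]
      by (simp add: distrib_right)
    moreover have "(l + (1 - t) * (\<alpha> * (1 + \<epsilon>) * (m * (\<kappa> - 1)))) * G0 \<le> P * G0"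
      using P(3) by (intro mult_right_mono) (auto simp: l_def G0_def)
    ultimately have nxt: "norm (g (Suc k) v* A) \<le> P * G0 + t\<^sup>2 * C * \<zeta> * G0\<^sup>2" by linarith
    have S: "0 \<le> t\<^sup>2 * C" using m \<kappa> by (simp add: C_def)
    have "0 \<le> G0" by (simp add: G0_def)
    note phases = convergence_phases[OF \<zeta> cb(5,6) this S P(1,2) nxt]
    show ?thesis using phase1 phases unfolding G0_def assms(21,22) by blast
  qed
  show ?thesis unfolding L using step unfolding assms(19)[symmetric] by blast
qed

end
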